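(* Let $\mathfrak{a}$ be a bilinear map on $H^1(\mathcal{O},\mathfrak{w})$ obeying the weak maximum principle property on $\mathcal{O}\cup\Sigma$ for $\mathfrak{K}$, for some relatively open subset $\Sigma\subseteq\partial\mathcal{O}$ and convex cone $\mathfrak{K}\subset H^1(\mathcal{O},\mathfrak{w})$ containing the constant function $1$, and assume that $\mathfrak{a}(1,\phi)\ge 0$ for all $\phi\in H^1_0(\mathcal{O}\cup\Sigma,\mathfrak{w})$ with $\phi\ge 0$ a.e. on $\mathcal{O}$. Consider, for a constant $c_0>0$, the condition (P) $\mathfrak{a}(1,\phi)\ge(c_0,\phi)_{L^2(\mathcal{O},\mathfrak{w})}$ for all $\phi\in H^1_0(\mathcal{O}\cup\Sigma,\mathfrak{w})$ with $\phi\ge 0$ a.e. on $\mathcal{O}$. Suppose that $u,-v\in\mathfrak{K}$, and let $f\in L^2(\mathcal{O},\mathfrak{w})$. 1. If $\mathfrak{a}(u,\cdot)\le 0$, then $u\le 0\vee\sup_{\partial\mathcal{O}\setminus\Sigma}u$ a.e. on $\mathcal{O}$. 2. If $\mathfrak{a}(u,\cdot)\le(f,\cdot)_{L^2(\mathcal{O},\mathfrak{w})}$, where $f$ has arbitrary sign but there is a constant $c_0>0$ such that (P) holds, then $u\le 0\vee\frac{1}{c_0}\operatorname{ess\,sup}_{\mathcal{O}}f\vee\sup_{\partial\mathcal{O}\setminus\Sigma}u$ a.e. on $\mathcal{O}$. 3. If $\mathfrak{a}(v,\cdot)\ge 0$, then $v\ge 0\wedge\inf_{\partial\mathcal{O}\setminus\Sigma}v$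 a.e. on $\mathcal{O}$. 4. If $\mathfrak{a}(v,\cdot)\ge(f,\cdot)_{L^2(\mathcal{O},\mathfrak{w})}$, where $f$ has arbitrary sign and (P) holds, then $v\ge 0\wedge\frac{1}{c_0}\operatorname{ess\,inf}_{\mathcal{O}}f\wedge\inf_{\partial\mathcal{O}\setminus\Sigma}v$ a.e. on $\mathcal{O}$. 5. If $u\in\mathfrak{K}\cap-\mathfrak{K}$ and $\mathfrak{a}(u,\cdot)=0$, then $\|u\|_{L^\infty(\mathcal{O})}\le\|u\|_{L^\infty(\partial\mathcal{O}\setminus\Sigma)}$. 6. If $u\in\mathfrak{K}\cap-\mathfrak{K}$ and $\mathfrak{a}(u,\cdot)=(f,\cdot)_{L^2(\mathcal{O},\mathfrak{w})}$, where $f$ has arbitrary sign and (P) holds, then $\|u\|_{L^\infty(\mathcal{O})}\le\frac{1}{c_0}\|f\|_{L^\infty(\mathcal{O})}\vee\|u\|_{L^\infty(\partial\mathcal{O}\setminus\Sigma)}$. The terms $\sup_{\partial\mathcal{O}\setminus\Sigma}u$, $\inf_{\partial\mathcal{O}\setminus\Sigma}v$, and $\|u\|_{L^\infty(\partial\mathcal{O}\setminus\Sigma)}$ are omitted when $\Sigma=\partial\mathcal{O}$.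
   Context: $\mathcal{O}\subseteq\mathbb{R}^d$ is open. A weight function on $\mathcal{O}$ is an element of $C(\mathcal{O})\cap L^1(\mathcal{O})$ that is positive on $\mathcal{O}$. Given weight functions $\mathfrak{w}_{0,0},\mathfrak{w}_{1,0},\mathfrak{w}_{1,1}$, $H^1(\mathcal{O},\mathfrak{w})$ is the completion of $C^\infty_0(\bar{\mathcal{O}})$ in the norm $\|u\|^2=\int_{\mathcal{O}}(|Du|^2\mathfrak{w}_{1,1}+|u|^2\mathfrak{w}_{1,0})\,dx$, and $L^2(\mathcal{O},\mathfrak{w})$ is the completion in the norm $\|u\|^2=\int_{\mathcal{O}}|u|^2\mathfrak{w}_{0,0}\,dx$, with continuous inclusion $H^1(\mathcal{O},\mathfrak{w})\subset L^2(\mathcal{O},\mathfrak{w})$. $C^\infty_0(\mathcal{O}\cup\Sigma)$ is the space of smooth functions with compact support in $\mathcal{O}\cup\Sigma$, and $H^1_0(\mathcal{O}\cup\Sigma,\mathfrak{w})$ is its closure in $H^1(\mathcal{O},\mathfrak{w})$. "$u\le l$ on $\partial\mathcal{O}\setminus\Sigma$ in the sense of $H^1(\mathcal{O},\mathfrak{w})$" means $(u-l)^+\in H^1_0(\mathcal{O}\cup\Sigma,\mathfrak{w})$. $\sup_{\partial\mathcal{O}\setminus\Sigma}u:=\inf\{l\in\mathbb{R}:u\le l\text{ on }\partial\mathcal{O}\setminus\Sigma\text{ in the sense of }H^1(\mathcal{O},\mathfrak{w})\}$; $\inf_{\partial\mathcal{O}\setminus\Sigma}v:=-\sup_{\partial\mathcal{O}\setminus\Sigma}(-v)$;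 $\|u\|_{L^\infty(\partial\mathcal{O}\setminus\Sigma)}$ is the corresponding bound $\sup_{\partial\mathcal{O}\setminus\Sigma}|u|$. Inequalities $\mathfrak{a}(u,\cdot)\le F$ between functionals mean $\mathfrak{a}(u,\phi)\le F(\phi)$ for all $\phi\in H^1_0(\mathcal{O}\cup\Sigma,\mathfrak{w})$ with $\phi\ge 0$ a.e. on $\mathcal{O}$. $x\vee y=\max\{x,y\}$, $x\wedge y=\min\{x,y\}$. Weak maximum principle property: $\mathfrak{a}$ obeys it on $\mathcal{O}\cup\Sigma$ for $\mathfrak{K}$ if whenever $u\in\mathfrak{K}$ obeys $\mathfrak{a}(u,\cdot)\le 0$ and $u\le 0$ on $\partial\mathcal{O}\setminus\Sigma$ in the sense of $H^1(\mathcal{O},\mathfrak{w})$, then $u\le 0$ a.e. on $\mathcal{O}$.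
   Formalization: The convex cone K is assumed to contain the constant function −1 as well as 1; with 1 alone the claim fails (O=(0,1), Σ empty, unit weights, a=0, u=1+sin πx, K={su+t : s,t≥0}). *)

theory Defs
  imports "HOL-Probability.Probability"
begin

text \<open>Throughout, \<open>Om\<close> is an open subset of a Euclidean space and \<open>Sg\<close> a portion of its boundary.
  Only the values on \<open>Om\<close> of a function matter; elements of the completions below are
  represented by functions, to be read modulo equality a.e. on \<open>Om\<close>.\<close>

definition weight_fun :: "'a::euclidean_space set \<Rightarrow> ('a \<Rightarrow> real) \<Rightarrow> bool" where
  "weight_fun Om w \<longleftrightarrow> continuous_on Om w \<and> integrable (lebesgue_on Om) w \<and> (\<forall>x\<in>Om. w x > 0)"

subsection \<open>Smooth functions with compact support\<close>

primrec iter_partial :: "'a::euclidean_space list \<Rightarrow> ('a \<Rightarrow> real) \<Rightarrow> 'a \<Rightarrow> real" where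
  "iter_partial [] u = u"
| "iter_partial (b # bs) u = (\<lambda>x. frechet_derivative (iter_partial bs u) (at x) b)"

text \<open>Smoothness on \<open>Om \<union> S\<close>, for \<open>S\<close> a part of the boundary: all partial derivatives exist on \<open>Om\<close>
  and extend continuously to \<open>Om \<union> S\<close> (the usual convention for \<open>C\<close>-infinity up to the
  boundary, which needs no regularity of the boundary).\<close>

definition smooth_up_to :: "'a::euclidean_space set \<Rightarrow> 'a set \<Rightarrow> ('a \<Rightarrow> real) \<Rightarrow> bool" where
  "smooth_up_to Om S u \<longleftrightarrow>
     (\<forall>bs\<in>lists Basis. iter_partial bs u differentiable_on Om \<and>
        (\<exists>g. continuous_on (Om \<union> S) g \<and> (\<forall>x\<in>Om. g x = iter_partial bs u x)))"

text \<open>\<open>test_fun Om (frontier Om)\<close> is the space of smooth functions with compact support in the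
  closure of \<open>Om\<close>.\<close>

definition test_fun :: "'a::euclidean_space set \<Rightarrow> 'a set \<Rightarrow> ('a \<Rightarrow> real) set" where
  "test_fun Om S = {u. smooth_up_to Om S u \<and>
     compact (closure {x\<in>Om. u x \<noteq> 0}) \<and> closure {x\<in>Om. u x \<noteq> 0} \<subseteq> Om \<union> S}"

subsection \<open>Weighted spaces\<close>

definition L2_norm2 :: "'a::euclidean_space set \<Rightarrow> ('a \<Rightarrow> real) \<Rightarrow> ('a \<Rightarrow> real) \<Rightarrow> ennreal" where
  "L2_norm2 Om w u = (\<integral>\<^sup>+x. ennreal ((u x)\<^sup>2 * w x) \<partial>lebesgue_on Om)"

definition H1_norm2 ::
  "'a::euclidean_space set \<Rightarrow> ('a \<Rightarrow> real) \<Rightarrow> ('a \<Rightarrow> real) \<Rightarrow> ('a \<Rightarrow> real) \<Rightarrow> ennreal" where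
  "H1_norm2 Om w10 w11 u =
     (\<integral>\<^sup>+x. ennreal ((\<Sum>b\<in>Basis. (frechet_derivative u (at x) b)\<^sup>2) * w11 x + (u x)\<^sup>2 * w10 x)
        \<partial>lebesgue_on Om)"

text \<open>Completion of the test functions in the weighted \<open>L\<close>2 norm, realised inside the
  measurable functions (where this norm is complete).\<close>

definition wL2 :: "'a::euclidean_space set \<Rightarrow> ('a \<Rightarrow> real) \<Rightarrow> ('a \<Rightarrow> real) set" where
  "wL2 Om w = {u \<in> borel_measurable (lebesgue_on Om).
     \<exists>\<phi>. range \<phi> \<subseteq> test_fun Om (frontier Om) \<and>
         (\<lambda>n. L2_norm2 Om w (\<lambda>x. \<phi> n x - u x)) \<longlonglongrightarrow> 0}"

definition wL2_inner ::
  "'a::euclidean_space set \<Rightarrow> ('a \<Rightarrow> real) \<Rightarrow> ('a \<Rightarrow> real) \<Rightarrow> ('a \<Rightarrow> real) \<Rightarrow> real" where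
  "wL2_inner Om w f g = (\<integral>x. f x * g x * w x \<partial>lebesgue_on Om)"

text \<open>The closure, in the completion of the test functions in the weighted \<open>H\<close>1 norm, of a set \<open>C\<close>
  of test functions. A point of the completion is given by an \<open>H\<close>1-Cauchy sequence, and is
  identified with the \<open>w10\<close>-weighted \<open>L\<close>2 limit of that sequence. The identification is injective:
  \<open>w10\<close> and \<open>w11\<close> are bounded below on compact subsets of \<open>Om\<close>, so the limit of the gradients is the
  weak gradient of the limit, and two Cauchy sequences with the same limit function differ by an
  \<open>H\<close>1-null sequence.\<close>

definition H1_closure ::
  "'a::euclidean_space set \<Rightarrow> ('a \<Rightarrow> real) \<Rightarrow> ('a \<Rightarrow> real) \<Rightarrow> ('a \<Rightarrow> real) set \<Rightarrow> ('a \<Rightarrow> real) set" where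
  "H1_closure Om w10 w11 C = {u \<in> borel_measurable (lebesgue_on Om).
     \<exists>\<phi>. range \<phi> \<subseteq> C \<and>
         (\<forall>e>0. \<exists>N. \<forall>m\<ge>N. \<forall>n\<ge>N. H1_norm2 Om w10 w11 (\<lambda>x. \<phi> m x - \<phi> n x) < e) \<and>
         (\<lambda>n. L2_norm2 Om w10 (\<lambda>x. \<phi> n x - u x)) \<longlonglongrightarrow> 0}"

definition wH1 :: "'a::euclidean_space set \<Rightarrow> ('a \<Rightarrow> real) \<Rightarrow> ('a \<Rightarrow> real) \<Rightarrow> ('a \<Rightarrow> real) set" where
  "wH1 Om w10 w11 = H1_closure Om w10 w11 (test_fun Om (frontier Om))"

definition wH10 ::
  "'a::euclidean_space set \<Rightarrow> ('a \<Rightarrow> real) \<Rightarrow> ('a \<Rightarrow> real) \<Rightarrow> 'a set \<Rightarrow> ('a \<Rightarrow> real) set" where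
  "wH10 Om w10 w11 Sg = H1_closure Om w10 w11 (test_fun Om Sg)"

text \<open>The inclusion is the extension of the identity of the common dense subspace of test functions,
  so its boundedness is the norm inequality on test functions.\<close>

definition H1_in_L2_continuous ::
  "'a::euclidean_space set \<Rightarrow> ('a \<Rightarrow> real) \<Rightarrow> ('a \<Rightarrow> real) \<Rightarrow> ('a \<Rightarrow> real) \<Rightarrow> bool" where
  "H1_in_L2_continuous Om w00 w10 w11 \<longleftrightarrow>
     wH1 Om w10 w11 \<subseteq> wL2 Om w00 \<and>
     (\<exists>c::real. \<forall>u\<in>test_fun Om (frontier Om).
        L2_norm2 Om w00 u \<le> ennreal c * H1_norm2 Om w10 w11 u)"

subsection \<open>Boundary inequalities in the sense of the weighted \<open>H\<close>1 space\<close>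

definition le_on_bdry ::
  "'a::euclidean_space set \<Rightarrow> ('a \<Rightarrow> real) \<Rightarrow> ('a \<Rightarrow> real) \<Rightarrow> 'a set \<Rightarrow> ('a \<Rightarrow> real) \<Rightarrow> real \<Rightarrow> bool" where
  "le_on_bdry Om w10 w11 Sg u l \<longleftrightarrow> (\<lambda>x. max (u x - l) 0) \<in> wH10 Om w10 w11 Sg"

definition bdry_sup ::
  "'a::euclidean_space set \<Rightarrow> ('a \<Rightarrow> real) \<Rightarrow> ('a \<Rightarrow> real) \<Rightarrow> 'a set \<Rightarrow> ('a \<Rightarrow> real) \<Rightarrow> ereal" where
  "bdry_sup Om w10 w11 Sg u = (INF l\<in>{l. le_on_bdry Om w10 w11 Sg u l}. ereal l)"

definition bdry_inf ::
  "'a::euclidean_space set \<Rightarrow> ('a \<Rightarrow> real) \<Rightarrow> ('a \<Rightarrow> real) \<Rightarrow> 'a set \<Rightarrow> ('a \<Rightarrow> real) \<Rightarrow> ereal" where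
  "bdry_inf Om w10 w11 Sg v = - bdry_sup Om w10 w11 Sg (\<lambda>x. - v x)"

text \<open>The boundary norm takes values in \<open>[0, \<infinity>]\<close>: \<^const>\<open>e2ennreal\<close> sends negative values to 0. These
  occur when the boundary portion carries no trace, where the infimum over all real bounds is \<open>-\<infinity>\<close>.\<close>

definition bdry_Linf_norm ::
  "'a::euclidean_space set \<Rightarrow> ('a \<Rightarrow> real) \<Rightarrow> ('a \<Rightarrow> real) \<Rightarrow> 'a set \<Rightarrow> ('a \<Rightarrow> real) \<Rightarrow> ennreal" where
  "bdry_Linf_norm Om w10 w11 Sg u = e2ennreal (bdry_sup Om w10 w11 Sg (\<lambda>x. \<bar>u x\<bar>))"

definition ess_sup_on :: "'a::euclidean_space set \<Rightarrow> ('a \<Rightarrow> real) \<Rightarrow> ereal" where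
  "ess_sup_on Om f = esssup (lebesgue_on Om) (\<lambda>x. ereal (f x))"

definition ess_inf_on :: "'a::euclidean_space set \<Rightarrow> ('a \<Rightarrow> real) \<Rightarrow> ereal" where
  "ess_inf_on Om f = - ess_sup_on Om (\<lambda>x. - f x)"

definition Linf_norm :: "'a::euclidean_space set \<Rightarrow> ('a \<Rightarrow> real) \<Rightarrow> ennreal" where
  "Linf_norm Om f = esssup (lebesgue_on Om) (\<lambda>x. ennreal \<bar>f x\<bar>)"

subsection \<open>Bilinear maps, cones, and the weak maximum principle property\<close>

text \<open>The last conjunct of the next two definitions says that the notion lives on classes modulo
  a.e. equality.\<close>

definition bilinear_map_on ::
  "'a::euclidean_space set \<Rightarrow> ('a \<Rightarrow> real) set \<Rightarrow> (('a \<Rightarrow> real) \<Rightarrow> ('a \<Rightarrow> real) \<Rightarrow> real) \<Rightarrow> bool" where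
  "bilinear_map_on Om H a \<longleftrightarrow>
     (\<forall>u\<in>H. \<forall>v\<in>H. \<forall>\<phi>\<in>H. \<forall>s t. a (\<lambda>x. s * u x + t * v x) \<phi> = s * a u \<phi> + t * a v \<phi>) \<and>
     (\<forall>u\<in>H. \<forall>\<phi>\<in>H. \<forall>\<psi>\<in>H. \<forall>s t. a u (\<lambda>x. s * \<phi> x + t * \<psi> x) = s * a u \<phi> + t * a u \<psi>) \<and>
     (\<forall>u\<in>H. \<forall>u'\<in>H. \<forall>\<phi>\<in>H. \<forall>\<phi>'\<in>H.
        (AE x in lebesgue_on Om. u x = u' x) \<longrightarrow> (AE x in lebesgue_on Om. \<phi> x = \<phi>' x) \<longrightarrow>
        a u \<phi> = a u' \<phi>')"

definition convex_cone_in ::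
  "'a::euclidean_space set \<Rightarrow> ('a \<Rightarrow> real) set \<Rightarrow> ('a \<Rightarrow> real) set \<Rightarrow> bool" where
  "convex_cone_in Om H K \<longleftrightarrow> K \<subseteq> H \<and>
     (\<forall>u\<in>K. \<forall>v\<in>K. \<forall>s\<ge>0. \<forall>t\<ge>0. (\<lambda>x. s * u x + t * v x) \<in> K) \<and>
     (\<forall>u\<in>K. \<forall>v\<in>H. (AE x in lebesgue_on Om. u x = v x) \<longrightarrow> v \<in> K)"

definition wH10_nonneg ::
  "'a::euclidean_space set \<Rightarrow> ('a \<Rightarrow> real) \<Rightarrow> ('a \<Rightarrow> real) \<Rightarrow> 'a set \<Rightarrow> ('a \<Rightarrow> real) set" where
  "wH10_nonneg Om w10 w11 Sg = {\<phi> \<in> wH10 Om w10 w11 Sg. AE x in lebesgue_on Om. 0 \<le> \<phi> x}"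

definition weak_max_principle ::
  "'a::euclidean_space set \<Rightarrow> ('a \<Rightarrow> real) \<Rightarrow> ('a \<Rightarrow> real) \<Rightarrow> 'a set \<Rightarrow> ('a \<Rightarrow> real) set \<Rightarrow>
   (('a \<Rightarrow> real) \<Rightarrow> ('a \<Rightarrow> real) \<Rightarrow> real) \<Rightarrow> bool" where
  "weak_max_principle Om w10 w11 Sg K a \<longleftrightarrow>
     (\<forall>u\<in>K. (\<forall>\<phi>\<in>wH10_nonneg Om w10 w11 Sg. a u \<phi> \<le> 0) \<longrightarrow>
        le_on_bdry Om w10 w11 Sg u 0 \<longrightarrow> (AE x in lebesgue_on Om. u x \<le> 0))"

definition condition_P ::
  "'a::euclidean_space set \<Rightarrow> ('a \<Rightarrow> real) \<Rightarrow> ('a \<Rightarrow> real) \<Rightarrow> ('a \<Rightarrow> real) \<Rightarrow> 'a set \<Rightarrow>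
   (('a \<Rightarrow> real) \<Rightarrow> ('a \<Rightarrow> real) \<Rightarrow> real) \<Rightarrow> real \<Rightarrow> bool" where
  "condition_P Om w00 w10 w11 Sg a c0 \<longleftrightarrow>
     (\<forall>\<phi>\<in>wH10_nonneg Om w10 w11 Sg. a (\<lambda>_. 1) \<phi> \<ge> wL2_inner Om w00 (\<lambda>_. c0) \<phi>)"

end

theory Submission
  imports Defs
begin

text \<open>If the bilinear map satisfies \<open>a u \<phi> \<le> l * a 1 \<phi>\<close> for all admissible \<open>\<phi> \<ge> 0\<close>, then \<open>u - l\<close> is a
  subsolution, and it lies in the cone because both constants \<open>1\<close> and \<open>-1\<close> do. If moreover \<open>u \<le> l\<close> on
  the part of the boundary outside \<open>Sg\<close>, the weak maximum principle gives \<open>u \<le> l\<close> a.e. For subsolutions the first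
  requirement holds for every \<open>l \<ge> 0\<close>, because \<open>a 1 \<phi> \<ge> 0\<close>. With a right-hand side \<open>f\<close> and condition (P) it
  holds as soon as also \<open>c0 * l \<ge> ess sup f\<close>, because then
  \<open>a u \<phi> \<le> (f, \<phi>) \<le> l * (c0, \<phi>) \<le> l * a 1 \<phi>\<close>. Letting \<open>l\<close> decrease to the claimed bound proves the two upper
  bounds (\<open>upper_bound\<close>); applied to \<open>-v\<close>, and to both \<open>u\<close> and \<open>-u\<close>, they yield the lower bounds and the
  two-sided ones.

  The substance is in what this argument takes for granted about boundary values. The levels \<open>l\<close>
  slightly above the bound must themselves satisfy \<open>u \<le> l\<close> on the boundary, although the infimum
  defining the boundary supremum only supplies some smaller level, possibly negative. So from
  \<open>(u - l)\<^sup>+\<close> in the closure of the test functions one has to conclude that \<open>(u - l')\<^sup>+\<close> is there too,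
  for \<open>l' \<ge> l\<close>. When \<open>Sg\<close> is the whole boundary, every level has to be admissible,
  that is, \<open>H1\<close> has to be closed under positive parts. Both follow from one truncation
  theorem (\<open>H1_closure_pos_part\<close>): the closure of the test functions contains \<open>(u - c)\<^sup>+\<close> together with \<open>u\<close>
  when \<open>c \<ge> 0\<close>. For the norm estimates, \<open>|u| \<le> l\<close> on the boundary has to imply \<open>u \<le> l\<close> there. This is an
  instance of domination (\<open>wH10_dominated\<close>): a nonnegative element of \<open>H1\<close> lying below an element of
  the subspace of functions vanishing on the boundary outside \<open>Sg\<close> belongs to that subspace. It follows from
  truncation because \<open>z = d - (d - z)\<^sup>+\<close> for \<open>z \<le> d\<close>.

  Truncation is proved with explicit approximants. The functions \<open>t * exp (- e / t)\<close>, extended by 0 to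
  \<open>t \<le> 0\<close>, are smooth, differ from \<open>t\<^sup>+\<close> by at most \<open>e\<close>, have slopes in \<open>[0, 1]\<close>, and these slopes are
  Lipschitz with constant \<open>27 / e\<close>. Given test functions \<open>\<phi> n\<close> converging to \<open>u\<close>, one composes the \<open>k\<close>-th
  regularisation, \<open>e = 1 / (k + 1)\<close>, with a member of the sequence so close to \<open>u\<close> that
  the Lipschitz constant is beaten. The slopes then converge a.e. to the indicator of
  \<open>{u > c}\<close>, and dominated convergence shows that their products with the gradients form a
  Cauchy sequence (\<open>L2_Cauchy_mult\<close>), which is what membership in the completion asks for.\<close>

section \<open>Smooth approximations of the positive part\<close>

text \<open>Infinite differentiability as a coinductive predicate: smoothness of a family closed under
  differentiation is then a one-line coinduction, and composition with functions of several
  variables needs only one derivative at a time.\<close>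
coinductive smooth_real :: "(real \<Rightarrow> real) \<Rightarrow> bool" where
  "(\<And>t. (h has_real_derivative h' t) (at t)) \<Longrightarrow> smooth_real h' \<Longrightarrow> smooth_real h"

text \<open>These are the functions that arise on differentiating the standard flat function \<open>exp (- e / t)\<close>.\<close>
definition flat_exp :: "real poly \<Rightarrow> real \<Rightarrow> real \<Rightarrow> real" where
  "flat_exp p e t = (if t > 0 then poly p (1 / t) * exp (- e / t) else 0)"

text \<open>In the variable \<open>s = 1 / t\<close> this is the decay of \<^const>\<open>flat_exp\<close> at the origin from the right.\<close>
lemma poly_times_exp_tendsto_0:
  fixes p :: "real poly"
  assumes "e > 0"
  shows "((\<lambda>s. poly p s * exp (- e * s)) \<longlongrightarrow> 0) at_top"
proof -
  have mono: "((\<lambda>s. s ^ k * exp (- e * s)) \<longlongrightarrow> 0) at_top" for k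
  proof -
    have "filterlim (\<lambda>s. e * s) at_top at_top"
      using assms by (intro filterlim_tendsto_pos_mult_at_top[OF tendsto_const]) (auto intro: filterlim_ident)
    from filterlim_compose[OF tendsto_power_div_exp_0[of k] this]
    have "((\<lambda>s. (e * s) ^ k / exp (e * s)) \<longlongrightarrow> 0) at_top" .
    from tendsto_mult_right[OF this, of "1 / e ^ k"]
    show ?thesis using assms
      by (simp add: power_mult_distrib exp_minus field_simps)
  qed
  have "((\<lambda>s. \<Sum>i\<le>degree p. coeff p i * (s ^ i * exp (- e * s))) \<longlongrightarrow> (\<Sum>i\<le>degree p. coeff p i * 0)) at_top"
    by (intro tendsto_intros mono)
  then show ?thesis
    by (simp add: poly_altdef sum_distrib_right mult.assoc)
qed

text \<open>Differentiating away from 0 multiplies by a polynomial in \<open>1 / t\<close>, so the family is closed under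
  differentiation; at 0 the difference quotient is again of this form and vanishes because the
  exponential decays faster than any power of \<open>1 / t\<close> grows.\<close>
lemma flat_exp_has_derivative:
  assumes "e > 0"
  shows "(flat_exp p e has_real_derivative flat_exp ([:0, 0, 1:] * (smult e p - pderiv p)) e t) (at t)"
proof -
  consider "t > 0" | "t < 0" | "t = 0" by linarith
  then show ?thesis
  proof cases
    case 1
    have "((\<lambda>t. poly p (1 / t) * exp (- e / t)) has_real_derivative
        flat_exp ([:0, 0, 1:] * (smult e p - pderiv p)) e t) (at t)"
      using 1 by (auto intro!: derivative_eq_intros simp: flat_exp_def power2_eq_square field_simps)
    then show ?thesis
      by (rule has_field_derivative_transform_within_open[where S = "{0<..}"]) (use 1 in \<open>auto simp: flat_exp_def\<close>)
  next
    case 2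
    have "((\<lambda>t. 0) has_real_derivative flat_exp ([:0, 0, 1:] * (smult e p - pderiv p)) e t) (at t)"
      using 2 by (simp add: flat_exp_def)
    then show ?thesis
      by (rule has_field_derivative_transform_within_open[where S = "{..<0}"]) (use 2 in \<open>auto simp: flat_exp_def\<close>)
  next
    case 3
    have "((\<lambda>t. poly (pCons 0 p) (1 / t) * exp (- e * (1 / t))) \<longlongrightarrow> 0) (at_right 0)"
      by (rule filterlim_compose[OF poly_times_exp_tendsto_0[OF assms]])
        (simp add: filterlim_inverse_at_top_right divide_inverse)
    then have "((\<lambda>t. flat_exp p e t / t) \<longlongrightarrow> 0) (at_right 0)"
      by (rule Lim_transform_eventually)
        (auto simp: flat_exp_def eventually_at_right_less intro!: eventually_mono[OF eventually_at_right_less[of 0]])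
    moreover have "((\<lambda>t. flat_exp p e t / t) \<longlongrightarrow> 0) (at_left 0)"
      by (rule Lim_transform_eventually[OF tendsto_const])
        (auto simp: flat_exp_def eventually_at_left_field intro!: exI[of _ "-1"])
    ultimately have "((\<lambda>t. flat_exp p e t / t) \<longlongrightarrow> 0) (at 0)"
      by (simp add: filterlim_split_at)
    then show ?thesis
      using 3 by (simp add: has_field_derivative_iff flat_exp_def)
  qed
qed

lemma smooth_real_flat_exp:
  assumes "e > 0"
  shows "smooth_real (flat_exp p e)"
  by (coinduction arbitrary: p) (use flat_exp_has_derivative[OF assms] in blast)

text \<open>A smooth substitute for the positive part. It vanishes identically on \<open>t \<le> 0\<close>, so composition with
  it does not enlarge supports.\<close>
definition smooth_pos :: "real \<Rightarrow> real \<Rightarrow> real" where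
  "smooth_pos e t = t * flat_exp 1 e t"

abbreviation smooth_step :: "real \<Rightarrow> real \<Rightarrow> real" where
  "smooth_step e \<equiv> flat_exp [:1, e:] e"

lemma smooth_pos_has_derivative:
  assumes "e > 0"
  shows "(smooth_pos e has_real_derivative smooth_step e t) (at t)"
  unfolding smooth_pos_def [abs_def]
  by (rule derivative_eq_intros flat_exp_has_derivative[OF assms] refl)+
    (simp add: flat_exp_def field_simps)

lemma smooth_real_smooth_pos: "e > 0 \<Longrightarrow> smooth_real (smooth_pos e)"
  by (rule smooth_real.intros[OF smooth_pos_has_derivative smooth_real_flat_exp])

lemma smooth_pos_nonneg: "0 \<le> smooth_pos e t"
  by (simp add: smooth_pos_def flat_exp_def)

lemma smooth_pos_eq_0: "t \<le> 0 \<Longrightarrow> smooth_pos e t = 0"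
  by (simp add: smooth_pos_def flat_exp_def)

lemma smooth_pos_approx:
  assumes "e > 0"
  shows "\<bar>smooth_pos e t - max t 0\<bar> \<le> e"
proof (cases "t > 0")
  case True
  have "1 - e / t \<le> exp (- e / t)"
    using exp_ge_add_one_self[of "- e / t"] by simp
  then have "t * (1 - e / t) \<le> t * exp (- e / t)"
    using True by (intro mult_left_mono) auto
  moreover have "t * exp (- e / t) \<le> t * 1"
    using True assms by (intro mult_left_mono) auto
  moreover have "t * (1 - e / t) = t - e"
    using True by (simp add: right_diff_distrib)
  ultimately show ?thesis
    using True by (simp add: smooth_pos_def flat_exp_def abs_le_iff)
qed (use assms in \<open>auto simp: smooth_pos_def flat_exp_def\<close>)

text \<open>With \<open>x = e / t\<close> this is \<open>(1 + x) * exp (- x) \<le> 1\<close>.\<close>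
lemma smooth_step_bounds:
  assumes "e > 0"
  shows "\<bar>smooth_step e t\<bar> \<le> 1"
proof (cases "t > 0")
  case True
  have "(1 + e / t) * exp (- e / t) \<le> exp (e / t) * exp (- e / t)"
    by (intro mult_right_mono exp_ge_add_one_self) auto
  then have "(1 + e / t) * exp (- e / t) \<le> 1" by (simp flip: exp_add)
  then show ?thesis using True assms by (simp add: flat_exp_def abs_mult)
qed (simp add: flat_exp_def)

text \<open>With \<open>x = e / t\<close> the derivative of the step is \<open>x ^ 3 * exp (- x) / e\<close>, and \<open>x ^ 3 \<le> 27 * exp x\<close> is the cube
  of \<open>x / 3 \<le> exp (x / 3)\<close>.\<close>
lemma smooth_step_Lipschitz:
  assumes "e > 0"
  shows "\<bar>smooth_step e s - smooth_step e t\<bar> \<le> 27 / e * \<bar>s - t\<bar>"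
proof -
  define q where "q = [:0, 0, 1:] * (smult e [:1, e:] - pderiv [:1, e:])"
  have q: "\<bar>flat_exp q e t\<bar> \<le> 27 / e" for t
  proof (cases "t > 0")
    case True
    define x where "x = e / t"
    have x: "x > 0" using True assms by (simp add: x_def)
    have "(x / 3) ^ 3 \<le> exp (x / 3) ^ 3"
      using x exp_ge_add_one_self[of "x / 3"] by (intro power_mono) linarith+
    also have "\<dots> = exp x" by (simp flip: exp_of_nat_mult)
    finally have "x ^ 3 \<le> 27 * exp x" by (simp add: power_divide)
    then have "x ^ 3 * exp (- x) \<le> 27" by (simp add: exp_minus field_simps)
    moreover have "flat_exp q e t = x ^ 3 * exp (- x) / e"
      using True assms by (simp add: flat_exp_def q_def x_def pderiv_pCons power3_eq_cube power2_eq_square field_simps)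
    ultimately show ?thesis
      using x assms by (simp add: abs_mult divide_right_mono)
  qed (use assms in \<open>simp add: flat_exp_def\<close>)
  have "norm (smooth_step e s - smooth_step e t) \<le> 27 / e * norm (s - t)"
    by (rule field_differentiable_bound[where S = UNIV and f' = "flat_exp q e"])
      (use q flat_exp_has_derivative[OF assms, of "[:1, e:]"] in \<open>auto simp: q_def\<close>)
  then show ?thesis by simp
qed

text \<open>At a fixed point the steps converge to the indicator of the positive reals. The same limit holds
  along points \<open>s n\<close> that approach \<open>t\<close> faster than the Lipschitz constants \<open>27 * (n + 1)\<close> grow.\<close>
lemma smooth_step_tendsto:
  assumes "(\<lambda>n. real (Suc n) * \<bar>s n - t\<bar>) \<longlonglongrightarrow> 0"
  shows "(\<lambda>n. smooth_step (1 / real (Suc n)) (s n)) \<longlonglongrightarrow> (if t > 0 then 1 else 0)"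
proof -
  have e0: "(\<lambda>n. 1 / real (Suc n)) \<longlonglongrightarrow> 0"
    by (rule LIMSEQ_Suc[OF lim_1_over_n])
  have "(\<lambda>n. smooth_step (1 / real (Suc n)) t) \<longlonglongrightarrow> (if t > 0 then 1 else 0)"
  proof (cases "t > 0")
    case True
    have "(\<lambda>n. (1 + (1 / real (Suc n)) / t) * exp (- (1 / real (Suc n)) / t)) \<longlonglongrightarrow> (1 + 0 / t) * exp (- 0 / t)"
      by (intro tendsto_intros e0) (use True in auto)
    then show ?thesis using True by (simp add: flat_exp_def field_simps)
  qed (simp add: flat_exp_def)
  moreover have "(\<lambda>n. smooth_step (1 / real (Suc n)) (s n) - smooth_step (1 / real (Suc n)) t) \<longlonglongrightarrow> 0"
  proof (rule Lim_null_comparison[OF always_eventually])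
    show "\<forall>n. norm (smooth_step (1 / real (Suc n)) (s n) - smooth_step (1 / real (Suc n)) t)
        \<le> 27 * (real (Suc n) * \<bar>s n - t\<bar>)"
    proof
      fix n
      have "27 / (1 / real (Suc n)) * \<bar>s n - t\<bar> = 27 * (real (Suc n) * \<bar>s n - t\<bar>)" by simp
      then show "norm (smooth_step (1 / real (Suc n)) (s n) - smooth_step (1 / real (Suc n)) t)
        \<le> 27 * (real (Suc n) * \<bar>s n - t\<bar>)"
        using smooth_step_Lipschitz[of "1 / real (Suc n)" "s n" t] by (simp del: of_nat_Suc)
    qed
    show "(\<lambda>n. 27 * (real (Suc n) * \<bar>s n - t\<bar>)) \<longlonglongrightarrow> 0"
      using tendsto_mult_right_zero[OF assms] .
  qed
  ultimately show ?thesis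
    using tendsto_add by fastforce
qed

section \<open>Composition of smooth functions up to the boundary\<close>

abbreviation dpart :: "'a::euclidean_space \<Rightarrow> ('a \<Rightarrow> real) \<Rightarrow> 'a \<Rightarrow> real" where
  "dpart b u \<equiv> (\<lambda>x. frechet_derivative u (at x) b)"

definition cont_up_to :: "'a::euclidean_space set \<Rightarrow> 'a set \<Rightarrow> ('a \<Rightarrow> real) \<Rightarrow> bool" where
  "cont_up_to Om S u \<longleftrightarrow> (\<exists>g. continuous_on (Om \<union> S) g \<and> (\<forall>x\<in>Om. g x = u x))"

text \<open>Finite-order smoothness up to the boundary, defined by peeling off the innermost derivative. In
  \<^const>\<open>iter_partial\<close> the outermost one is peeled off, which does not suit the product and chain rules:
  these say what the first derivative of a product or a composition is.\<close>
primrec ck_up_to :: "nat \<Rightarrow> 'a::euclidean_space set \<Rightarrow> 'a set \<Rightarrow> ('a \<Rightarrow> real) \<Rightarrow> bool" where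
  "ck_up_to 0 Om S u \<longleftrightarrow> cont_up_to Om S u"
| "ck_up_to (Suc n) Om S u \<longleftrightarrow>
     cont_up_to Om S u \<and> u differentiable_on Om \<and> (\<forall>b\<in>Basis. ck_up_to n Om S (dpart b u))"

lemma iter_partial_append: "iter_partial (bs @ cs) u = iter_partial bs (iter_partial cs u)"
  by (induction bs) auto

lemma smooth_up_to_dpart:
  assumes "smooth_up_to Om S u" "b \<in> Basis"
  shows "smooth_up_to Om S (dpart b u)"
proof -
  have "iter_partial bs (dpart b u) = iter_partial (bs @ [b]) u" for bs
    by (simp add: iter_partial_append)
  moreover have "bs @ [b] \<in> lists Basis" if "bs \<in> lists Basis" for bs
    using that assms(2) by simp
  ultimately show ?thesis
    using assms(1) unfolding smooth_up_to_def by metis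
qed

lemma smooth_up_to_imp:
  assumes "smooth_up_to Om S u"
  shows "u differentiable_on Om" "cont_up_to Om S u"
  using assms[unfolded smooth_up_to_def, rule_format, of "[]"]
  by (auto simp: cont_up_to_def)

lemma smooth_up_to_iff_ck: "smooth_up_to Om S u \<longleftrightarrow> (\<forall>n. ck_up_to n Om S u)"
proof
  assume "smooth_up_to Om S u"
  then have "ck_up_to n Om S u" for n
    by (induction n arbitrary: u) (auto simp: smooth_up_to_imp smooth_up_to_dpart)
  then show "\<forall>n. ck_up_to n Om S u" by blast
next
  have "iter_partial bs u differentiable_on Om \<and> cont_up_to Om S (iter_partial bs u)"
    if "bs \<in> lists Basis" "\<forall>n. ck_up_to n Om S u" for bs
    using that
  proof (induction bs arbitrary: u rule: rev_induct)
    case Nil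
    then have "ck_up_to (Suc 0) Om S u" by blast
    then show ?case by simp
  next
    case (snoc b bs)
    have "\<forall>n. ck_up_to n Om S (dpart b u)"
    proof
      fix n
      have "ck_up_to (Suc n) Om S u" using snoc.prems by blast
      with snoc.prems(1) show "ck_up_to n Om S (dpart b u)" by simp
    qed
    with snoc show ?case by (simp add: iter_partial_append)
  qed
  then show "\<forall>n. ck_up_to n Om S u \<Longrightarrow> smooth_up_to Om S u"
    by (auto simp: smooth_up_to_def cont_up_to_def)
qed

lemma ck_up_to_Suc_imp: "ck_up_to (Suc n) Om S u \<Longrightarrow> ck_up_to n Om S u"
proof (induction n arbitrary: u)
  case (Suc n)
  from Suc.prems Suc.IH show ?case by (simp add: ck_up_to.simps(2)[of "Suc n"] ck_up_to.simps(2)[of n] del: ck_up_to.simps)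
qed simp

lemma cont_up_to_cong: "(\<And>x. x \<in> Om \<Longrightarrow> u x = v x) \<Longrightarrow> cont_up_to Om S u \<longleftrightarrow> cont_up_to Om S v"
  by (simp add: cont_up_to_def)

lemma dpart_eqI:
  assumes "(u has_derivative D) (at x)"
  shows "frechet_derivative u (at x) b = D b"
  using frechet_derivative_at[OF assms] by simp

lemma dpart_cong_open:
  assumes "open Om" "x \<in> Om" "\<And>x. x \<in> Om \<Longrightarrow> u x = v x"
  shows "frechet_derivative u (at x) b = frechet_derivative v (at x) b"
proof -
  have "(u has_derivative D) (at x) \<longleftrightarrow> (v has_derivative D) (at x)" for D
    using assms by (metis has_derivative_transform_within_open)
  then show ?thesis by (simp add: frechet_derivative_def)
qed

lemma differentiable_on_open_has_derivative:
  assumes "open Om" "u differentiable_on Om" "x \<in> Om"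
  shows "(u has_derivative frechet_derivative u (at x)) (at x)"
  using assms by (metis differentiable_on_eq_differentiable_at frechet_derivative_works)

lemma ck_up_to_cong:
  assumes "open Om" "\<And>x. x \<in> Om \<Longrightarrow> u x = v x" "ck_up_to n Om S u"
  shows "ck_up_to n Om S v"
  using assms(2,3)
proof (induction n arbitrary: u v)
  case 0
  then show ?case using cont_up_to_cong[of Om u v S] by simp
next
  case (Suc n)
  have "v differentiable_on Om"
    unfolding differentiable_on_eq_differentiable_at[OF assms(1)]
  proof
    fix x assume x: "x \<in> Om"
    with Suc.prems have "(u has_derivative frechet_derivative u (at x)) (at x)"
      by (intro differentiable_on_open_has_derivative[OF assms(1)]) auto
    then show "v differentiable (at x)"
      using has_derivative_transform_within_open[OF _ assms(1) x Suc.prems(1)]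
      by (meson differentiable_def)
  qed
  moreover have "ck_up_to n Om S (dpart b v)" if "b \<in> Basis" for b
  proof (rule Suc.IH[of "dpart b u"])
    show "ck_up_to n Om S (dpart b u)" using Suc.prems that by simp
    show "dpart b u x = dpart b v x" if "x \<in> Om" for x
      by (rule dpart_cong_open[OF assms(1) that Suc.prems(1)])
  qed
  ultimately show ?case
    using Suc.prems cont_up_to_cong[of Om u v S] by simp
qed

lemma cont_up_to_diff:
  "cont_up_to Om S u \<Longrightarrow> cont_up_to Om S v \<Longrightarrow> cont_up_to Om S (\<lambda>x. u x - v x)"
  unfolding cont_up_to_def
  by (elim exE, rule_tac x = "\<lambda>x. g x - ga x" in exI) (auto intro: continuous_intros)

lemma cont_up_to_add:
  "cont_up_to Om S u \<Longrightarrow> cont_up_to Om S v \<Longrightarrow> cont_up_to Om S (\<lambda>x. u x + v x)"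
  unfolding cont_up_to_def
  by (elim exE, rule_tac x = "\<lambda>x. g x + ga x" in exI) (auto intro: continuous_intros)

lemma cont_up_to_mult:
  "cont_up_to Om S u \<Longrightarrow> cont_up_to Om S v \<Longrightarrow> cont_up_to Om S (\<lambda>x. u x * v x)"
  unfolding cont_up_to_def
  by (elim exE, rule_tac x = "\<lambda>x. g x * ga x" in exI) (auto intro: continuous_intros)

lemma dpart_add:
  assumes "open Om" "u differentiable_on Om" "v differentiable_on Om" "x \<in> Om"
  shows "frechet_derivative (\<lambda>x. u x + v x) (at x) b
    = frechet_derivative u (at x) b + frechet_derivative v (at x) b"
  using assms by (intro dpart_eqI has_derivative_add differentiable_on_open_has_derivative)

lemma dpart_diff:
  assumes "open Om" "u differentiable_on Om" "v differentiable_on Om" "x \<in> Om"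
  shows "frechet_derivative (\<lambda>x. u x - v x) (at x) b
    = frechet_derivative u (at x) b - frechet_derivative v (at x) b"
  using assms by (intro dpart_eqI has_derivative_diff differentiable_on_open_has_derivative)

lemma ck_up_to_add:
  assumes "open Om" "ck_up_to n Om S u" "ck_up_to n Om S v"
  shows "ck_up_to n Om S (\<lambda>x. u x + v x)"
  using assms(2,3)
proof (induction n arbitrary: u v)
  case (Suc n)
  then have d: "u differentiable_on Om" "v differentiable_on Om" by auto
  have "ck_up_to n Om S (dpart b (\<lambda>x. u x + v x))" if "b \<in> Basis" for b
    by (rule ck_up_to_cong[OF assms(1) _ Suc.IH[of "dpart b u" "dpart b v"]])
      (use that Suc.prems in \<open>auto simp: dpart_add[OF assms(1) d]\<close>)
  then show ?case using Suc.prems by (auto intro: cont_up_to_add differentiable_on_add)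
qed (auto intro: cont_up_to_add)

lemma ck_up_to_diff:
  assumes "open Om" "ck_up_to n Om S u" "ck_up_to n Om S v"
  shows "ck_up_to n Om S (\<lambda>x. u x - v x)"
  using assms(2,3)
proof (induction n arbitrary: u v)
  case (Suc n)
  then have d: "u differentiable_on Om" "v differentiable_on Om" by auto
  have "ck_up_to n Om S (dpart b (\<lambda>x. u x - v x))" if "b \<in> Basis" for b
    by (rule ck_up_to_cong[OF assms(1) _ Suc.IH[of "dpart b u" "dpart b v"]])
      (use that Suc.prems in \<open>auto simp: dpart_diff[OF assms(1) d]\<close>)
  then show ?case using Suc.prems by (auto intro: cont_up_to_diff differentiable_on_diff)
qed (auto intro: cont_up_to_diff)

lemma ck_up_to_mult:
  assumes "open Om" "ck_up_to n Om S u" "ck_up_to n Om S v"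
  shows "ck_up_to n Om S (\<lambda>x. u x * v x)"
  using assms(2,3)
proof (induction n arbitrary: u v)
  case (Suc n)
  then have d: "u differentiable_on Om" "v differentiable_on Om" by auto
  have eq: "frechet_derivative (\<lambda>x. u x * v x) (at x) b
      = u x * frechet_derivative v (at x) b + frechet_derivative u (at x) b * v x" if "x \<in> Om" for x b
    using that assms(1) d
    by (intro dpart_eqI has_derivative_mult differentiable_on_open_has_derivative)
  have "ck_up_to n Om S (dpart b (\<lambda>x. u x * v x))" if "b \<in> Basis" for b
  proof (rule ck_up_to_cong[OF assms(1)])
    show "ck_up_to n Om S (\<lambda>x. u x * dpart b v x + dpart b u x * v x)"
      using that Suc.prems ck_up_to_Suc_imp[of n Om S]
      by (intro ck_up_to_add[OF assms(1)] Suc.IH) (auto simp del: ck_up_to.simps simp: ck_up_to.simps(2)[of n])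
  qed (simp add: eq)
  then show ?case using Suc.prems by (auto intro: cont_up_to_mult differentiable_on_mult)
qed (auto intro: cont_up_to_mult)

lemma ck_up_to_const: "ck_up_to n Om S (\<lambda>x. c)"
proof -
  have c: "cont_up_to Om S (\<lambda>x. c)" for c
    unfolding cont_up_to_def by (rule exI[of _ "\<lambda>x. c"]) simp
  show ?thesis
    by (induction n arbitrary: c) (simp_all add: c)
qed

lemma smooth_real_continuous: "smooth_real h \<Longrightarrow> continuous_on UNIV h"
  by (erule smooth_real.cases) (blast intro: DERIV_isCont continuous_at_imp_continuous_on)

lemma has_derivative_real_comp:
  assumes "(h has_real_derivative d) (at (u x))" "(u has_derivative D) (at x)"
  shows "((\<lambda>x. h (u x)) has_derivative (\<lambda>v. d * D v)) (at x)"
  using has_derivative_compose[OF assms(2) assms(1)[unfolded has_field_derivative_def]] by simp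

lemma cont_up_to_compose:
  assumes "smooth_real h" "cont_up_to Om S u"
  shows "cont_up_to Om S (\<lambda>x. h (u x))"
proof -
  from assms(2) obtain g where g: "continuous_on (Om \<union> S) g" "\<forall>x\<in>Om. g x = u x"
    unfolding cont_up_to_def by blast
  then have "continuous_on (Om \<union> S) (\<lambda>x. h (g x))"
    by (intro continuous_on_compose2[OF smooth_real_continuous[OF assms(1)]]) auto
  with g(2) show ?thesis unfolding cont_up_to_def by auto
qed

text \<open>The first derivative of \<open>h \<circ> u\<close> is the product of \<open>h' \<circ> u\<close>, covered by the induction hypothesis because
  \<open>h'\<close> is again smooth, with a derivative of \<open>u\<close>.\<close>
lemma ck_up_to_compose:
  assumes "open Om" "smooth_real h" "ck_up_to n Om S u"
  shows "ck_up_to n Om S (\<lambda>x. h (u x))"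
  using assms(2,3)
proof (induction n arbitrary: h)
  case 0
  then show ?case
    by (simp add: cont_up_to_compose)
next
  case (Suc n)
  from Suc.prems(1) obtain h' where h': "\<And>t. (h has_real_derivative h' t) (at t)" "smooth_real h'"
    by cases blast
  have c: "cont_up_to Om S (\<lambda>x. h (u x))"
    using Suc.prems by (simp add: cont_up_to_compose)
  have d: "((\<lambda>x. h (u x)) has_derivative (\<lambda>v. h' (u x) * frechet_derivative u (at x) v)) (at x)"
    if "x \<in> Om" for x
    using that Suc.prems(2)
    by (intro has_derivative_real_comp h'(1) differentiable_on_open_has_derivative[OF assms(1)]) auto
  have "ck_up_to n Om S (dpart b (\<lambda>x. h (u x)))" if "b \<in> Basis" for b
  proof (rule ck_up_to_cong[OF assms(1)])
    show "ck_up_to n Om S (\<lambda>x. h' (u x) * dpart b u x)"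
      using that Suc.prems(2)
      by (intro ck_up_to_mult[OF assms(1)] Suc.IH[OF h'(2) ck_up_to_Suc_imp]) auto
  qed (simp add: dpart_eqI[OF d])
  moreover have "(\<lambda>x. h (u x)) differentiable_on Om"
    using d by (meson differentiable_def differentiable_at_imp_differentiable_on)
  ultimately show ?case using c by simp
qed

lemma smooth_up_to_diff:
  "open Om \<Longrightarrow> smooth_up_to Om S u \<Longrightarrow> smooth_up_to Om S v \<Longrightarrow> smooth_up_to Om S (\<lambda>x. u x - v x)"
  by (simp add: smooth_up_to_iff_ck ck_up_to_diff)

lemma smooth_up_to_const: "smooth_up_to Om S (\<lambda>x. c)"
  by (simp add: smooth_up_to_iff_ck ck_up_to_const)

lemma smooth_up_to_compose:
  "open Om \<Longrightarrow> smooth_real h \<Longrightarrow> smooth_up_to Om S u \<Longrightarrow> smooth_up_to Om S (\<lambda>x. h (u x))"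
  by (simp add: smooth_up_to_iff_ck ck_up_to_compose)

section \<open>Test functions\<close>

lemma test_funI:
  assumes "smooth_up_to Om S u" "\<And>x. x \<in> Om \<Longrightarrow> x \<notin> T \<Longrightarrow> u x = 0" "compact T" "T \<subseteq> Om \<union> S"
  shows "u \<in> test_fun Om S"
proof -
  have T: "{x \<in> Om. u x \<noteq> 0} \<subseteq> T"
    using assms(2) by blast
  then have "closure {x \<in> Om. u x \<noteq> 0} \<subseteq> T"
    by (rule closure_minimal[OF _ compact_imp_closed[OF assms(3)]])
  moreover have "compact (closure {x \<in> Om. u x \<noteq> 0})"
    unfolding compact_closure using T by (rule bounded_subset[OF compact_imp_bounded[OF assms(3)]])
  ultimately show ?thesis
    using assms(1,4) unfolding test_fun_def by blast
qed

lemma test_funE: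
  assumes "u \<in> test_fun Om S"
  obtains T where "smooth_up_to Om S u" "\<And>x. x \<in> Om \<Longrightarrow> x \<notin> T \<Longrightarrow> u x = 0" "compact T" "T \<subseteq> Om \<union> S"
  using assms closure_subset[of "{x \<in> Om. u x \<noteq> 0}"]
  by (intro that[of "closure {x \<in> Om. u x \<noteq> 0}"]) (auto simp: test_fun_def)

lemma smooth_up_to_mono:
  assumes "smooth_up_to Om S' u" "S \<subseteq> S'"
  shows "smooth_up_to Om S u"
  unfolding smooth_up_to_def
proof (intro ballI conjI)
  fix bs :: "'a list" assume bs: "bs \<in> lists Basis"
  with assms(1) obtain g where "iter_partial bs u differentiable_on Om"
      "continuous_on (Om \<union> S') g" "\<forall>x\<in>Om. g x = iter_partial bs u x"
    unfolding smooth_up_to_def by blast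
  moreover from this(2) have "continuous_on (Om \<union> S) g"
    using assms(2) by (auto intro: continuous_on_subset)
  ultimately show "iter_partial bs u differentiable_on Om"
    "\<exists>g. continuous_on (Om \<union> S) g \<and> (\<forall>x\<in>Om. g x = iter_partial bs u x)" by blast+
qed

lemma iter_partial_eq_0:
  assumes "open U" "\<And>x. x \<in> U \<Longrightarrow> u x = 0" "x \<in> U"
  shows "iter_partial bs u x = 0"
  using assms(3)
proof (induction bs arbitrary: x)
  case (Cons b bs)
  have "frechet_derivative (iter_partial bs u) (at x) b = frechet_derivative (\<lambda>_. 0) (at x) b"
    by (rule dpart_cong_open[OF assms(1) Cons.prems]) (rule Cons.IH)
  then show ?case by simp
qed (simp add: assms(2))

text \<open>A test function with support in \<open>Om \<union> S\<close> extends by 0 to the rest of the boundary. Relative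
  openness of \<open>S\<close> makes this continuous: \<open>Om \<union> S\<close> and the complement of the support are then
  both open in \<open>Om \<union> frontier Om\<close> and cover it. On the overlap the continuous extension of a derivative
  vanishes, since it does so on the dense set of points of \<open>Om\<close> outside the support.\<close>
lemma test_fun_subset:
  fixes S :: "'a::euclidean_space set"
  assumes "open Om" "openin (top_of_set (frontier Om)) S"
  shows "test_fun Om S \<subseteq> test_fun Om (frontier Om)"
proof
  fix u assume "u \<in> test_fun Om S"
  then obtain T where u: "smooth_up_to Om S u" "\<And>x. x \<in> Om \<Longrightarrow> x \<notin> T \<Longrightarrow> u x = 0" "compact T" "T \<subseteq> Om \<union> S"
    by (rule test_funE) blast
  have S: "S \<subseteq> frontier Om" using openin_imp_subset[OF assms(2)] .
  have clT: "closed T" using u(3) by (rule compact_imp_closed)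
  obtain V where V: "open V" "S = frontier Om \<inter> V"
    using assms(2) by (auto simp: openin_open)
  let ?W = "Om \<union> frontier Om"
  have op1: "openin (top_of_set ?W) (Om \<union> S)"
    unfolding openin_open using V assms(1) by (intro exI[of _ "Om \<union> V"]) auto
  have op2: "openin (top_of_set ?W) (?W - T)"
    using clT by (metis Diff_eq openin_open_Int open_Compl)
  have W: "Om \<union> S \<union> (?W - T) = ?W" using u(4) S by auto
  have "smooth_up_to Om (frontier Om) u"
    unfolding smooth_up_to_def
  proof (intro ballI conjI)
    fix bs :: "'a list" assume bs: "bs \<in> lists Basis"
    with u(1) obtain g where "iter_partial bs u differentiable_on Om"
      and g: "continuous_on (Om \<union> S) g" "\<forall>x\<in>Om. g x = iter_partial bs u x"
      unfolding smooth_up_to_def by blast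
    then show "iter_partial bs u differentiable_on Om" by blast
    have z: "iter_partial bs u x = 0" if "x \<in> Om - T" for x
      using that u(2) by (intro iter_partial_eq_0[of "Om - T"] open_Diff assms(1) clT) auto
    have g0: "g x = 0" if x: "x \<in> Om \<union> S" "x \<notin> T" for x
    proof -
      have "closedin (top_of_set (Om \<union> S)) {y \<in> Om \<union> S. g y = 0}"
        using continuous_closedin_preimage_constant[OF g(1)] .
      then obtain C where C: "closed C" "{y \<in> Om \<union> S. g y = 0} = C \<inter> (Om \<union> S)"
        by (auto simp: closedin_closed)
      have "Om - T \<subseteq> C" using C(2) z g(2) by auto
      then have "closure (Om - T) \<subseteq> C" using C(1) by (rule closure_minimal)
      moreover have "x \<in> closure (Om - T)"
      proof -
        have "x \<in> closure Om" using x(1) S closure_subset[of Om] by (auto simp: frontier_def)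
        then show ?thesis
          using open_Int_closure_subset[of "- T" Om] clT x(2)
          by (auto simp: Diff_eq Int_commute open_Compl)
      qed
      ultimately show ?thesis using C(2) x(1) by auto
    qed
    have "continuous_on (Om \<union> S \<union> (?W - T)) (\<lambda>x. if x \<in> T then g x else 0)"
      by (rule continuous_on_cases_local_open)
        (use g0 op1 op2 g(1) in \<open>auto simp: W\<close>)
    then show "\<exists>g. continuous_on ?W g \<and> (\<forall>x\<in>Om. g x = iter_partial bs u x)"
      using g(2) z by (intro exI[of _ "\<lambda>x. if x \<in> T then g x else 0"]) (auto simp: W)
  qed
  then show "u \<in> test_fun Om (frontier Om)"
    by (rule test_funI[OF _ u(2,3)]) (use u(4) S in auto)
qed

lemma test_fun_dpart:
  assumes "open Om" "u \<in> test_fun Om S" "b \<in> Basis"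
  shows "dpart b u \<in> test_fun Om S"
proof -
  from assms(2) obtain T where u: "smooth_up_to Om S u" "\<And>x. x \<in> Om \<Longrightarrow> x \<notin> T \<Longrightarrow> u x = 0" "compact T" "T \<subseteq> Om \<union> S"
    by (rule test_funE) blast
  have "iter_partial [b] u x = 0" if "x \<in> Om - T" for x
    using that u(2) by (intro iter_partial_eq_0[of "Om - T"] open_Diff assms(1) compact_imp_closed u(3)) auto
  then show ?thesis
    by (intro test_funI[OF smooth_up_to_dpart[OF u(1) assms(3)] _ u(3,4)]) auto
qed

lemma test_fun_bounded:
  assumes "u \<in> test_fun Om S"
  obtains B where "\<And>x. x \<in> Om \<Longrightarrow> \<bar>u x\<bar> \<le> B"
proof -
  from assms obtain T where u: "smooth_up_to Om S u" "\<And>x. x \<in> Om \<Longrightarrow> x \<notin> T \<Longrightarrow> u x = 0" "compact T" "T \<subseteq> Om \<union> S"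
    by (rule test_funE) blast
  from smooth_up_to_imp(2)[OF u(1)] obtain g where
    g: "continuous_on (Om \<union> S) g" "\<forall>x\<in>Om. g x = u x" by (auto simp: cont_up_to_def)
  have "bounded (g ` T)"
    using g(1) u(3,4) by (meson compact_continuous_image compact_imp_bounded continuous_on_subset)
  then obtain B where B: "\<forall>x\<in>T. norm (g x) \<le> B" by (auto simp: bounded_iff)
  have "\<bar>u x\<bar> \<le> max B 0" if "x \<in> Om" for x
  proof (cases "u x = 0")
    case False
    then have "x \<in> T" using that u(2) by blast
    then show ?thesis using B g(2) that by (auto simp: le_max_iff_disj)
  qed simp
  then show ?thesis by (rule that)
qed

lemma test_fun_differentiable: "u \<in> test_fun Om S \<Longrightarrow> u differentiable_on Om"
  by (auto elim: test_funE dest: smooth_up_to_imp)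

lemma test_fun_diff:
  assumes "open Om" "u \<in> test_fun Om S" "v \<in> test_fun Om S"
  shows "(\<lambda>x. u x - v x) \<in> test_fun Om S"
proof -
  from assms(2) obtain T where u: "smooth_up_to Om S u" "\<And>x. x \<in> Om \<Longrightarrow> x \<notin> T \<Longrightarrow> u x = 0" "compact T" "T \<subseteq> Om \<union> S"
    by (rule test_funE) blast
  from assms(3) obtain T' where v: "smooth_up_to Om S v" "\<And>x. x \<in> Om \<Longrightarrow> x \<notin> T' \<Longrightarrow> v x = 0" "compact T'" "T' \<subseteq> Om \<union> S"
    by (rule test_funE) blast
  show ?thesis
    by (rule test_funI[OF smooth_up_to_diff[OF assms(1) u(1) v(1)], of "T \<union> T'"]) (use u v in auto)
qed

lemma test_fun_smooth_pos:
  assumes "open Om" "u \<in> test_fun Om S" "e > 0" "c \<ge> 0"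
  shows "(\<lambda>x. smooth_pos e (u x - c)) \<in> test_fun Om S"
proof -
  from assms(2) obtain T where u: "smooth_up_to Om S u" "\<And>x. x \<in> Om \<Longrightarrow> x \<notin> T \<Longrightarrow> u x = 0" "compact T" "T \<subseteq> Om \<union> S"
    by (rule test_funE) blast
  have "smooth_up_to Om S (\<lambda>x. smooth_pos e (u x - c))"
    by (rule smooth_up_to_compose[OF assms(1) smooth_real_smooth_pos[OF assms(3)]])
      (rule smooth_up_to_diff[OF assms(1) u(1) smooth_up_to_const])
  then show ?thesis
    by (rule test_funI[OF _ _ u(3,4)]) (use u(2) assms(4) in \<open>simp add: smooth_pos_eq_0\<close>)
qed

lemma borel_measurable_on_open:
  "open Om \<Longrightarrow> continuous_on Om f \<Longrightarrow> f \<in> borel_measurable (lebesgue_on Om)"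
  for f :: "'a::euclidean_space \<Rightarrow> real"
  by (intro continuous_imp_measurable_on_sets_lebesgue) auto

lemma test_fun_measurable:
  assumes "open Om" "u \<in> test_fun Om S"
  shows "u \<in> borel_measurable (lebesgue_on Om)"
  by (intro borel_measurable_on_open assms differentiable_imp_continuous_on
      test_fun_differentiable[OF assms(2)])

section \<open>Weighted square norms\<close>

lemma weight_fun_measurable:
  "open Om \<Longrightarrow> weight_fun Om w \<Longrightarrow> w \<in> borel_measurable (lebesgue_on Om)"
  by (simp add: weight_fun_def borel_measurable_integrable)

lemma weight_fun_pos: "weight_fun Om w \<Longrightarrow> x \<in> Om \<Longrightarrow> w x > 0"
  by (simp add: weight_fun_def)

lemma L2_norm2_measurable_integrand:
  assumes "open Om" "weight_fun Om w" "u \<in> borel_measurable (lebesgue_on Om)"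
  shows "(\<lambda>x. ennreal ((u x)\<^sup>2 * w x)) \<in> borel_measurable (lebesgue_on Om)"
proof -
  note [measurable] = assms(3) weight_fun_measurable[OF assms(1,2)]
  show ?thesis by measurable
qed

lemma L2_norm2_cong: "(\<And>x. x \<in> Om \<Longrightarrow> u x = v x) \<Longrightarrow> L2_norm2 Om w u = L2_norm2 Om w v"
  unfolding L2_norm2_def by (intro nn_integral_cong) auto

text \<open>A triangle inequality for squared norms, from \<open>(s + t)\<^sup>2 \<le> 2 * s\<^sup>2 + 2 * t\<^sup>2\<close>. The factor 2 is harmless
  because squared norms only ever have to be made small.\<close>
lemma L2_norm2_le_add:
  assumes Om: "open Om" and w: "weight_fun Om w"
    and m: "u \<in> borel_measurable (lebesgue_on Om)" "v \<in> borel_measurable (lebesgue_on Om)"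
    and le: "\<And>x. x \<in> Om \<Longrightarrow> \<bar>h x\<bar> \<le> \<bar>u x\<bar> + \<bar>v x\<bar>"
  shows "L2_norm2 Om w h \<le> 2 * L2_norm2 Om w u + 2 * L2_norm2 Om w v"
proof -
  note meas = L2_norm2_measurable_integrand[OF Om w]
  have "ennreal ((h x)\<^sup>2 * w x) \<le> 2 * ennreal ((u x)\<^sup>2 * w x) + 2 * ennreal ((v x)\<^sup>2 * w x)" if "x \<in> Om" for x
  proof -
    have "(h x)\<^sup>2 \<le> (\<bar>u x\<bar> + \<bar>v x\<bar>)\<^sup>2"
      using power_mono[OF le[OF that], of 2] by simp
    also have "\<dots> \<le> 2 * (u x)\<^sup>2 + 2 * (v x)\<^sup>2"
      using sum_squares_bound[of "\<bar>u x\<bar>" "\<bar>v x\<bar>"] by (simp add: power2_sum)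
    finally have "(h x)\<^sup>2 * w x \<le> 2 * ((u x)\<^sup>2 * w x) + 2 * ((v x)\<^sup>2 * w x)"
      using mult_right_mono[of "(h x)\<^sup>2" "2 * (u x)\<^sup>2 + 2 * (v x)\<^sup>2" "w x"] weight_fun_pos[OF w that]
      by (simp add: algebra_simps)
    moreover have "2 * ennreal r = ennreal (2 * r)" if "r \<ge> 0" for r
      using that by (simp add: ennreal_mult')
    ultimately show ?thesis
      using weight_fun_pos[OF w that] by (simp add: flip: ennreal_plus)
  qed
  then have "L2_norm2 Om w h
      \<le> (\<integral>\<^sup>+x. 2 * ennreal ((u x)\<^sup>2 * w x) + 2 * ennreal ((v x)\<^sup>2 * w x) \<partial>lebesgue_on Om)"
    unfolding L2_norm2_def by (intro nn_integral_mono) auto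
  also have "\<dots> = 2 * L2_norm2 Om w u + 2 * L2_norm2 Om w v"
    unfolding L2_norm2_def using meas[OF m(1)] meas[OF m(2)]
    by (subst nn_integral_add) (auto simp: nn_integral_cmult)
  finally show ?thesis .
qed

lemma L2_norm2_const_less_top:
  assumes "open Om" "weight_fun Om w"
  shows "L2_norm2 Om w (\<lambda>_. c) < \<infinity>"
proof -
  have "integrable (lebesgue_on Om) (\<lambda>x. c\<^sup>2 * w x)"
    using assms(2) by (simp add: weight_fun_def)
  then have "(\<integral>\<^sup>+x. ennreal (norm (c\<^sup>2 * w x)) \<partial>lebesgue_on Om) < \<infinity>"
    unfolding integrable_iff_bounded by (rule conjunct2)
  moreover have "L2_norm2 Om w (\<lambda>_. c) \<le> (\<integral>\<^sup>+x. ennreal (norm (c\<^sup>2 * w x)) \<partial>lebesgue_on Om)"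
    unfolding L2_norm2_def by (intro nn_integral_mono ennreal_leI) auto
  ultimately show ?thesis by (meson le_less_trans)
qed

lemma L2_norm2_test_fun_less_top:
  assumes "open Om" "weight_fun Om w" "u \<in> test_fun Om S"
  shows "L2_norm2 Om w u < \<infinity>"
proof -
  obtain B where B: "\<And>x. x \<in> Om \<Longrightarrow> \<bar>u x\<bar> \<le> B" using test_fun_bounded[OF assms(3)] by blast
  have "L2_norm2 Om w u \<le> L2_norm2 Om w (\<lambda>_. B)"
    unfolding L2_norm2_def
    by (intro nn_integral_mono ennreal_leI mult_right_mono)
      (auto intro!: B abs_le_square_iff[THEN iffD1] less_imp_le[OF weight_fun_pos[OF assms(2)]] order_trans[OF B abs_ge_self])
  then show ?thesis using L2_norm2_const_less_top[OF assms(1,2)] by (meson le_less_trans)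
qed

text \<open>The pointwise sum has finite integral, hence is finite a.e.\<close>
lemma AE_summable_tendsto_0:
  assumes m: "\<And>n::nat. f n \<in> borel_measurable M" and nn: "\<And>n x. x \<in> space M \<Longrightarrow> 0 \<le> f n x"
    and le: "\<And>n. (\<integral>\<^sup>+x. ennreal (f n x) \<partial>M) \<le> ennreal (c n)"
    and c: "summable c" "\<And>n. 0 \<le> c n"
  shows "AE x in M. (\<lambda>n. f n x) \<longlonglongrightarrow> 0"
proof -
  note m[measurable]
  have "(\<integral>\<^sup>+x. (\<Sum>n. ennreal (f n x)) \<partial>M) = (\<Sum>n. \<integral>\<^sup>+x. ennreal (f n x) \<partial>M)"
    by (intro nn_integral_suminf) auto
  also have "\<dots> \<le> (\<Sum>n. ennreal (c n))" by (intro suminf_le le) auto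
  also have "\<dots> < \<infinity>" using ennreal_suminf_neq_top[OF c] by (simp add: less_top)
  finally have "AE x in M. (\<Sum>n. ennreal (f n x)) \<noteq> \<infinity>"
    by (intro nn_integral_PInf_AE) auto
  then show ?thesis
    using AE_space
  proof eventually_elim
    case (elim x)
    then have "summable (\<lambda>n. f n x)" using nn by (intro summable_suminf_not_top) auto
    then show ?case by (rule summable_LIMSEQ_zero)
  qed
qed

definition L2_Cauchy :: "'a::euclidean_space set \<Rightarrow> ('a \<Rightarrow> real) \<Rightarrow> (nat \<Rightarrow> 'a \<Rightarrow> real) \<Rightarrow> bool" where
  "L2_Cauchy Om w U \<longleftrightarrow>
     (\<forall>e>0. \<exists>N. \<forall>m\<ge>N. \<forall>n\<ge>N. L2_norm2 Om w (\<lambda>x. U m x - U n x) < e)"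

lemma L2_Cauchy_subseq:
  assumes "L2_Cauchy Om w U" "strict_mono r"
  shows "L2_Cauchy Om w (\<lambda>n. U (r n))"
  using assms(1) seq_suble[OF assms(2)] unfolding L2_Cauchy_def by (meson le_trans)

lemma ennreal_exists_small_multiple: 
  fixes e :: ennreal
  assumes "e > 0" "c > 0" "c < top"
  obtains d where "d > 0" "c * d < e"
proof (cases "e = top")
  case True
  then show ?thesis using assms by (intro that[of 1]) auto
next
  case False
  obtain r where r: "e = ennreal r" "r > 0" using False assms(1)
    by (cases e rule: ennreal_cases) (auto simp: ennreal_less_zero_iff top_unique)
  obtain k where k: "c = ennreal k" "k > 0" using assms(2,3)
    by (cases c rule: ennreal_cases) (auto simp: ennreal_less_zero_iff top_unique)
  show ?thesis
  proof (rule that[of "ennreal (r / (2 * k))"])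
    show "0 < ennreal (r / (2 * k))" using r k by simp
    have "k * (r / (2 * k)) < r" using r k by simp
    then show "c * ennreal (r / (2 * k)) < e" using r k
      by (simp add: ennreal_less_iff flip: ennreal_mult)
  qed
qed

lemma L2_Cauchy_if_tendsto:
  assumes Om: "open Om" and w: "weight_fun Om w"
    and m: "\<And>n. U n \<in> borel_measurable (lebesgue_on Om)" "u \<in> borel_measurable (lebesgue_on Om)"
    and lim: "(\<lambda>n. L2_norm2 Om w (\<lambda>x. U n x - u x)) \<longlonglongrightarrow> 0"
  shows "L2_Cauchy Om w U"
  unfolding L2_Cauchy_def
proof (intro allI impI)
  fix e :: ennreal assume "e > 0"
  then obtain d where d: "d > 0" "4 * d < e" using ennreal_exists_small_multiple[of e 4] by auto
  obtain N where N: "\<And>n. n \<ge> N \<Longrightarrow> L2_norm2 Om w (\<lambda>x. U n x - u x) < d"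
    using order_tendstoD(2)[OF lim d(1)] by (auto simp: eventually_sequentially)
  have "L2_norm2 Om w (\<lambda>x. U m x - U n x) < e" if "m \<ge> N" "n \<ge> N" for m n
  proof -
    have "L2_norm2 Om w (\<lambda>x. U m x - U n x)
      \<le> 2 * L2_norm2 Om w (\<lambda>x. U m x - u x) + 2 * L2_norm2 Om w (\<lambda>x. U n x - u x)"
      using m by (intro L2_norm2_le_add[OF Om w]) auto
    also have "\<dots> \<le> 2 * d + 2 * d"
      using N that by (intro add_mono mult_left_mono) (auto intro: less_imp_le)
    also have "\<dots> = 4 * d" by (simp flip: distrib_right)
    finally show ?thesis using d(2) by simp
  qed
  then show "\<exists>N. \<forall>m\<ge>N. \<forall>n\<ge>N. L2_norm2 Om w (\<lambda>x. U m x - U n x) < e" by blast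
qed

lemma L2_Cauchy_diff:
  assumes Om: "open Om" and w: "weight_fun Om w"
    and m: "\<And>n. U n \<in> borel_measurable (lebesgue_on Om)" "\<And>n. V n \<in> borel_measurable (lebesgue_on Om)"
    and C: "L2_Cauchy Om w U" "L2_Cauchy Om w V"
  shows "L2_Cauchy Om w (\<lambda>n x. U n x - V n x)"
  unfolding L2_Cauchy_def
proof (intro allI impI)
  fix e :: ennreal assume "e > 0"
  then obtain d where d: "d > 0" "4 * d < e" using ennreal_exists_small_multiple[of e 4] by auto
  obtain N where N: "\<And>m n. m \<ge> N \<Longrightarrow> n \<ge> N \<Longrightarrow> L2_norm2 Om w (\<lambda>x. U m x - U n x) < d"
    using C(1) d(1) unfolding L2_Cauchy_def by meson
  obtain N' where N': "\<And>m n. m \<ge> N' \<Longrightarrow> n \<ge> N' \<Longrightarrow> L2_norm2 Om w (\<lambda>x. V m x - V n x) < d"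
    using C(2) d(1) unfolding L2_Cauchy_def by meson
  have "L2_norm2 Om w (\<lambda>x. (U m x - V m x) - (U n x - V n x)) < e" if "m \<ge> max N N'" "n \<ge> max N N'" for m n
  proof -
    have "L2_norm2 Om w (\<lambda>x. (U m x - V m x) - (U n x - V n x))
      \<le> 2 * L2_norm2 Om w (\<lambda>x. U m x - U n x) + 2 * L2_norm2 Om w (\<lambda>x. V m x - V n x)"
      using m by (intro L2_norm2_le_add[OF Om w]) auto
    also have "\<dots> \<le> 2 * d + 2 * d"
      using N N' that by (intro add_mono mult_left_mono) (auto intro: less_imp_le)
    also have "\<dots> = 4 * d" by (simp flip: distrib_right)
    finally show ?thesis using d(2) by simp
  qed
  then show "\<exists>N. \<forall>m\<ge>N. \<forall>n\<ge>N. L2_norm2 Om w (\<lambda>x. (U m x - V m x) - (U n x - V n x)) < e" by blast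
qed

text \<open>Fix \<open>N\<close> so large that \<open>D N\<close> is close to all later \<open>D n\<close>. Then \<open>A n * D n\<close> is close to \<open>A n * D N\<close> since
  \<open>|A n| \<le> 1\<close>, and \<open>A n * D N\<close> converges to \<open>P * D N\<close> by dominated convergence, with the integrable majorant
  \<open>(2 * D N)\<^sup>2 * w\<close>. The late member \<open>D N\<close> thus stands in for the limit of the sequence \<open>D\<close>.\<close>
lemma L2_Cauchy_mult:
  assumes Om: "open Om" and w: "weight_fun Om w"
    and m: "\<And>n. D n \<in> borel_measurable (lebesgue_on Om)" "\<And>n. A n \<in> borel_measurable (lebesgue_on Om)"
      "P \<in> borel_measurable (lebesgue_on Om)"
    and C: "L2_Cauchy Om w D" and fin: "\<And>n. L2_norm2 Om w (D n) < \<infinity>"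
    and A: "\<And>n x. x \<in> Om \<Longrightarrow> \<bar>A n x\<bar> \<le> 1" "\<And>x. \<bar>P x\<bar> \<le> 1"
    and lim: "AE x in lebesgue_on Om. (\<lambda>n. A n x) \<longlonglongrightarrow> P x"
  shows "L2_Cauchy Om w (\<lambda>n x. A n x * D n x)"
  unfolding L2_Cauchy_def
proof (intro allI impI)
  fix e :: ennreal assume "e > 0"
  \<comment> \<open>16 is the factor 2 + 2 of the triangle inequality for squares, used twice in succession.\<close>
  then obtain d where d: "d > 0" "16 * d < e" using ennreal_exists_small_multiple[of e 16] by auto
  obtain N where N: "\<And>m n. m \<ge> N \<Longrightarrow> n \<ge> N \<Longrightarrow> L2_norm2 Om w (\<lambda>x. D m x - D n x) < d"
    using C(1) d(1) unfolding L2_Cauchy_def by meson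
  note [measurable] = m weight_fun_measurable[OF Om w]
  have fin': "L2_norm2 Om w (\<lambda>x. 2 * D N x) < \<infinity>"
  proof -
    have "L2_norm2 Om w (\<lambda>x. 2 * D N x) \<le> 2 * L2_norm2 Om w (D N) + 2 * L2_norm2 Om w (D N)"
      by (intro L2_norm2_le_add[OF Om w]) (auto simp: abs_mult)
    also have "\<dots> < \<infinity>" using fin[of N] by (simp add: ennreal_mult_less_top)
    finally show ?thesis .
  qed
  have "(\<lambda>n. L2_norm2 Om w (\<lambda>x. (A n x - P x) * D N x)) \<longlonglongrightarrow> (\<integral>\<^sup>+x. 0 \<partial>lebesgue_on Om)"
    unfolding L2_norm2_def
  proof (rule nn_integral_dominated_convergence[where w = "\<lambda>x. ennreal ((2 * D N x)\<^sup>2 * w x)"])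
    show "(\<integral>\<^sup>+x. ennreal ((2 * D N x)\<^sup>2 * w x) \<partial>lebesgue_on Om) < \<infinity>"
      using fin' by (simp add: L2_norm2_def)
    show "AE x in lebesgue_on Om. ennreal (((A n x - P x) * D N x)\<^sup>2 * w x) \<le> ennreal ((2 * D N x)\<^sup>2 * w x)" for n
    proof (intro AE_I2 ennreal_leI mult_right_mono)
      fix x assume x: "x \<in> space (lebesgue_on Om)"
      then have "\<bar>(A n x - P x) * D N x\<bar> \<le> \<bar>2 * D N x\<bar>"
        using A(1)[of x n] A(2)[of x] by (auto simp: abs_mult intro!: mult_right_mono)
      then show "((A n x - P x) * D N x)\<^sup>2 \<le> (2 * D N x)\<^sup>2" by (simp add: abs_le_square_iff)
      show "0 \<le> w x" using weight_fun_pos[OF w] x by (simp add: less_imp_le)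
    qed
    show "AE x in lebesgue_on Om. (\<lambda>n. ennreal (((A n x - P x) * D N x)\<^sup>2 * w x)) \<longlonglongrightarrow> 0"
      using lim
    proof eventually_elim
      case (elim x)
      have "(\<lambda>n. ennreal (((A n x - P x) * D N x)\<^sup>2 * w x)) \<longlonglongrightarrow> ennreal (((P x - P x) * D N x)\<^sup>2 * w x)"
        by (intro tendsto_intros elim)
      then show ?case by simp
    qed
  qed (measurable)
  then have "(\<lambda>n. L2_norm2 Om w (\<lambda>x. (A n x - P x) * D N x)) \<longlonglongrightarrow> 0" by simp
  from order_tendstoD(2)[OF this d(1)] obtain N' where
    N': "\<And>n. n \<ge> N' \<Longrightarrow> L2_norm2 Om w (\<lambda>x. (A n x - P x) * D N x) < d"
    by (auto simp: eventually_sequentially)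
  have half: "L2_norm2 Om w (\<lambda>x. A n x * D n x - P x * D N x) \<le> 4 * d" if "n \<ge> max N N'" for n
  proof -
    have "L2_norm2 Om w (\<lambda>x. A n x * D n x - P x * D N x)
      \<le> 2 * L2_norm2 Om w (\<lambda>x. D n x - D N x) + 2 * L2_norm2 Om w (\<lambda>x. (A n x - P x) * D N x)"
    proof (intro L2_norm2_le_add[OF Om w])
      fix x assume x: "x \<in> Om"
      have "A n x * D n x - P x * D N x = A n x * (D n x - D N x) + (A n x - P x) * D N x"
        by (simp add: algebra_simps)
      then have "\<bar>A n x * D n x - P x * D N x\<bar> \<le> \<bar>A n x * (D n x - D N x)\<bar> + \<bar>(A n x - P x) * D N x\<bar>"
        by (simp only: abs_triangle_ineq)
      also have "\<bar>A n x * (D n x - D N x)\<bar> \<le> 1 * \<bar>D n x - D N x\<bar>"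
        unfolding abs_mult by (intro mult_right_mono A x) auto
      finally show "\<bar>A n x * D n x - P x * D N x\<bar> \<le> \<bar>D n x - D N x\<bar> + \<bar>(A n x - P x) * D N x\<bar>"
        by simp
    qed measurable
    also have "\<dots> \<le> 2 * d + 2 * d"
      using N[of n N] N'[of n] that by (intro add_mono mult_left_mono) (auto intro: less_imp_le)
    also have "\<dots> = 4 * d" by (simp flip: distrib_right)
    finally show ?thesis .
  qed
  have "L2_norm2 Om w (\<lambda>x. A m x * D m x - A n x * D n x) < e" if "m \<ge> max N N'" "n \<ge> max N N'" for m n
  proof -
    have "L2_norm2 Om w (\<lambda>x. A m x * D m x - A n x * D n x)
      \<le> 2 * L2_norm2 Om w (\<lambda>x. A m x * D m x - P x * D N x) + 2 * L2_norm2 Om w (\<lambda>x. A n x * D n x - P x * D N x)"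
    proof (rule L2_norm2_le_add[OF Om w])
      show "\<bar>A m x * D m x - A n x * D n x\<bar>
          \<le> \<bar>A m x * D m x - P x * D N x\<bar> + \<bar>A n x * D n x - P x * D N x\<bar>" for x
        using abs_triangle_ineq4[of "A m x * D m x - P x * D N x" "A n x * D n x - P x * D N x"] by simp
    qed measurable
    also have "\<dots> \<le> 2 * (4 * d) + 2 * (4 * d)"
      using half that by (intro add_mono mult_left_mono) auto
    also have "\<dots> = 16 * d" by (simp flip: distrib_right mult.assoc)
    finally show ?thesis using d(2) by simp
  qed
  then show "\<exists>N. \<forall>m\<ge>N. \<forall>n\<ge>N. L2_norm2 Om w (\<lambda>x. A m x * D m x - A n x * D n x) < e" by blast
qed

section \<open>Truncation in the weighted Sobolev space\<close>

text \<open>The approximation required by \<^const>\<open>H1_closure\<close>, with the Cauchy condition on the full norm reduced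
  to the partial derivatives; the remaining part of the norm is controlled by convergence to \<open>u\<close>.\<close>
definition H1_approx ::
  "'a::euclidean_space set \<Rightarrow> ('a \<Rightarrow> real) \<Rightarrow> ('a \<Rightarrow> real) \<Rightarrow> (nat \<Rightarrow> 'a \<Rightarrow> real) \<Rightarrow> ('a \<Rightarrow> real) \<Rightarrow> bool" where
  "H1_approx Om w10 w11 \<phi> u \<longleftrightarrow>
     (\<lambda>n. L2_norm2 Om w10 (\<lambda>x. \<phi> n x - u x)) \<longlonglongrightarrow> 0 \<and>
     (\<forall>b\<in>Basis. L2_Cauchy Om w11 (\<lambda>n. dpart b (\<phi> n)))"

lemma H1_approx_subseq:
  assumes "H1_approx Om w10 w11 \<phi> u" "strict_mono r"
  shows "H1_approx Om w10 w11 (\<lambda>n. \<phi> (r n)) u"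
  unfolding H1_approx_def
proof (intro conjI ballI)
  show "(\<lambda>n. L2_norm2 Om w10 (\<lambda>x. \<phi> (r n) x - u x)) \<longlonglongrightarrow> 0"
    using LIMSEQ_subseq_LIMSEQ[OF _ assms(2), of "\<lambda>n. L2_norm2 Om w10 (\<lambda>x. \<phi> n x - u x)" 0] assms(1)
    by (simp add: H1_approx_def o_def)
  show "L2_Cauchy Om w11 (\<lambda>n. dpart b (\<phi> (r n)))" if "b \<in> Basis" for b
    by (rule L2_Cauchy_subseq[where U = "\<lambda>n. dpart b (\<phi> n)", OF _ assms(2)])
      (use assms(1) that in \<open>simp add: H1_approx_def\<close>)
qed

lemma test_fun_dpart_measurable:
  "open Om \<Longrightarrow> u \<in> test_fun Om S \<Longrightarrow> b \<in> Basis \<Longrightarrow> dpart b u \<in> borel_measurable (lebesgue_on Om)"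
  by (rule test_fun_measurable[OF _ test_fun_dpart])

lemma H1_norm2_eq_sum:
  assumes Om: "open Om" and w: "weight_fun Om w10" "weight_fun Om w11" and u: "u \<in> test_fun Om S"
  shows "H1_norm2 Om w10 w11 u = (\<Sum>b\<in>Basis. L2_norm2 Om w11 (dpart b u)) + L2_norm2 Om w10 u"
proof -
  note [measurable] = test_fun_measurable[OF Om u] test_fun_dpart_measurable[OF Om u]
    weight_fun_measurable[OF Om w(1)] weight_fun_measurable[OF Om w(2)]
  have "H1_norm2 Om w10 w11 u = (\<integral>\<^sup>+x. (\<Sum>b\<in>Basis. ennreal ((dpart b u x)\<^sup>2 * w11 x))
      + ennreal ((u x)\<^sup>2 * w10 x) \<partial>lebesgue_on Om)"
    unfolding H1_norm2_def
  proof (rule nn_integral_cong)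
    fix x assume "x \<in> space (lebesgue_on Om)"
    then have x: "w10 x > 0" "w11 x > 0" using weight_fun_pos w by auto
    then show "ennreal ((\<Sum>b\<in>Basis. (dpart b u x)\<^sup>2) * w11 x + (u x)\<^sup>2 * w10 x)
        = (\<Sum>b\<in>Basis. ennreal ((dpart b u x)\<^sup>2 * w11 x)) + ennreal ((u x)\<^sup>2 * w10 x)"
      by (subst sum_ennreal) (auto simp: sum_distrib_right sum_nonneg simp flip: ennreal_plus)
  qed
  also have "\<dots> = (\<Sum>b\<in>Basis. L2_norm2 Om w11 (dpart b u)) + L2_norm2 Om w10 u"
    unfolding L2_norm2_def
    by (subst nn_integral_add) (auto simp: nn_integral_sum intro!: borel_measurable_sum)
  finally show ?thesis .
qed

lemma H1_norm2_diff_eq_sum: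
  assumes Om: "open Om" and w: "weight_fun Om w10" "weight_fun Om w11"
    and uv: "u \<in> test_fun Om S" "v \<in> test_fun Om S"
  shows "H1_norm2 Om w10 w11 (\<lambda>x. u x - v x)
    = (\<Sum>b\<in>Basis. L2_norm2 Om w11 (\<lambda>x. dpart b u x - dpart b v x)) + L2_norm2 Om w10 (\<lambda>x. u x - v x)"
  unfolding H1_norm2_eq_sum[OF Om w test_fun_diff[OF Om uv]]
  by (intro arg_cong2[where f = "(+)"] sum.cong refl L2_norm2_cong dpart_diff[OF Om]
      test_fun_differentiable[OF uv(1)] test_fun_differentiable[OF uv(2)])

lemma H1_Cauchy_iff:
  fixes \<phi> :: "nat \<Rightarrow> 'a::euclidean_space \<Rightarrow> real"
  assumes Om: "open Om" and w: "weight_fun Om w10" "weight_fun Om w11"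
    and \<phi>: "\<And>n. \<phi> n \<in> test_fun Om S"
  shows "(\<forall>e>0. \<exists>N. \<forall>m\<ge>N. \<forall>n\<ge>N. H1_norm2 Om w10 w11 (\<lambda>x. \<phi> m x - \<phi> n x) < e) \<longleftrightarrow>
     L2_Cauchy Om w10 \<phi> \<and> (\<forall>b\<in>Basis. L2_Cauchy Om w11 (\<lambda>n. dpart b (\<phi> n)))"
    (is "?L \<longleftrightarrow> ?R")
proof
  assume L: ?L
  have le: "L2_norm2 Om w10 (\<lambda>x. \<phi> m x - \<phi> n x) \<le> H1_norm2 Om w10 w11 (\<lambda>x. \<phi> m x - \<phi> n x)"
    "b \<in> Basis \<Longrightarrow> L2_norm2 Om w11 (\<lambda>x. dpart b (\<phi> m) x - dpart b (\<phi> n) x) \<le> H1_norm2 Om w10 w11 (\<lambda>x. \<phi> m x - \<phi> n x)"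
    for m n b
    unfolding H1_norm2_diff_eq_sum[OF Om w \<phi> \<phi>]
    by (auto intro!: add_increasing2 member_le_sum[of b Basis "\<lambda>b. L2_norm2 Om w11 (\<lambda>x. dpart b (\<phi> m) x - dpart b (\<phi> n) x)"])
  show ?R
    unfolding L2_Cauchy_def using L le by (meson le_less_trans)
next
  assume R: ?R
  show ?L
  proof (intro allI impI)
    fix e :: ennreal assume e: "e > 0"
    obtain d where d: "d > 0" "(of_nat DIM('a) + 1) * d < e"
      by (rule ennreal_exists_small_multiple[OF e, of "of_nat DIM('a) + 1"]) (auto simp: add_pos_pos of_nat_less_top)
    from R d(1) have "\<forall>b\<in>Basis. \<exists>N. \<forall>m\<ge>N. \<forall>n\<ge>N. L2_norm2 Om w11 (\<lambda>x. dpart b (\<phi> m) x - dpart b (\<phi> n) x) < d"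
      unfolding L2_Cauchy_def by blast
    then obtain N where N: "\<And>b m n. b \<in> Basis \<Longrightarrow> m \<ge> N b \<Longrightarrow> n \<ge> N b \<Longrightarrow>
        L2_norm2 Om w11 (\<lambda>x. dpart b (\<phi> m) x - dpart b (\<phi> n) x) < d"
      by metis
    from R d(1) obtain N0 where N0: "\<And>m n. m \<ge> N0 \<Longrightarrow> n \<ge> N0 \<Longrightarrow> L2_norm2 Om w10 (\<lambda>x. \<phi> m x - \<phi> n x) < d"
      unfolding L2_Cauchy_def by blast
    define M where "M = Max (insert N0 (N ` Basis))"
    have M: "N0 \<le> M" "\<And>b. b \<in> Basis \<Longrightarrow> N b \<le> M" unfolding M_def by (auto intro!: Max_ge simp del: Max_insert)
    have "H1_norm2 Om w10 w11 (\<lambda>x. \<phi> m x - \<phi> n x) < e" if "m \<ge> M" "n \<ge> M" for m n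
    proof -
      have "H1_norm2 Om w10 w11 (\<lambda>x. \<phi> m x - \<phi> n x) \<le> (\<Sum>b\<in>(Basis::'a set). d) + d"
        unfolding H1_norm2_diff_eq_sum[OF Om w \<phi> \<phi>]
        by (intro add_mono sum_mono N[THEN less_imp_le] N0[THEN less_imp_le]) (use M that in \<open>auto intro: order_trans\<close>)
      also have "\<dots> = (of_nat DIM('a) + 1) * d" by (simp add: distrib_right)
      finally show ?thesis using d(2) by simp
    qed
    then show "\<exists>N. \<forall>m\<ge>N. \<forall>n\<ge>N. H1_norm2 Om w10 w11 (\<lambda>x. \<phi> m x - \<phi> n x) < e" by blast
  qed
qed

lemma H1_closure_iff:
  assumes Om: "open Om" and w: "weight_fun Om w10" "weight_fun Om w11"
  shows "u \<in> H1_closure Om w10 w11 (test_fun Om S) \<longleftrightarrow>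
    u \<in> borel_measurable (lebesgue_on Om) \<and>
    (\<exists>\<phi>. (\<forall>n. \<phi> n \<in> test_fun Om S) \<and> H1_approx Om w10 w11 \<phi> u)"
proof (cases "u \<in> borel_measurable (lebesgue_on Om)")
  case u: True
  have "range \<phi> \<subseteq> test_fun Om S \<and>
      (\<forall>e>0. \<exists>N. \<forall>m\<ge>N. \<forall>n\<ge>N. H1_norm2 Om w10 w11 (\<lambda>x. \<phi> m x - \<phi> n x) < e) \<and>
      (\<lambda>n. L2_norm2 Om w10 (\<lambda>x. \<phi> n x - u x)) \<longlonglongrightarrow> 0
    \<longleftrightarrow> (\<forall>n. \<phi> n \<in> test_fun Om S) \<and> H1_approx Om w10 w11 \<phi> u" for \<phi>
  proof (cases "\<forall>n. \<phi> n \<in> test_fun Om S")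
    case True
    then have t: "\<And>n. \<phi> n \<in> test_fun Om S" by blast
    show ?thesis
      unfolding H1_Cauchy_iff[OF Om w t] H1_approx_def
      using t L2_Cauchy_if_tendsto[where U = \<phi>, OF Om w(1) test_fun_measurable[OF Om t] u]
      by (auto simp: image_subset_iff)
  qed blast
  then show ?thesis
    using u by (simp add: H1_closure_def)
qed (simp add: H1_closure_def)

lemma strict_mono_seq_small:
  fixes a :: "nat \<Rightarrow> ennreal" and c :: "nat \<Rightarrow> real"
  assumes "a \<longlonglongrightarrow> 0" "\<And>n. c n > 0"
  obtains r where "strict_mono (r :: nat \<Rightarrow> nat)" "\<And>n. a (r n) \<le> ennreal (c n)"
proof -
  have ev: "\<exists>N. \<forall>n\<ge>N. a n < ennreal (c k)" for k
    using order_tendstoD(2)[OF assms(1), of "ennreal (c k)"] assms(2)[of k]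
    by (simp add: eventually_sequentially ennreal_less_zero_iff)
  have "\<exists>r. \<forall>n. a (r n) < ennreal (c n) \<and> r n < r (Suc n)"
  proof (rule dependent_nat_choice)
    show "\<exists>x. a x < ennreal (c 0)" using ev[of 0] by blast
    show "\<exists>y. a y < ennreal (c (Suc n)) \<and> x < y" for x n
    proof -
      obtain N where "\<forall>n'\<ge>N. a n' < ennreal (c (Suc n))" using ev by blast
      then show ?thesis by (intro exI[of _ "max N (Suc x)"]) auto
    qed
  qed
  then obtain r where "\<And>n. a (r n) < ennreal (c n)" "\<And>n. r n < r (Suc n)" by blast
  then show ?thesis by (intro that[of r]) (auto simp: strict_mono_Suc_iff intro: less_imp_le)
qed

lemma dpart_smooth_pos:
  assumes "open Om" "u differentiable_on Om" "x \<in> Om" "e > 0"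
  shows "dpart b (\<lambda>x. smooth_pos e (u x - c)) x = smooth_step e (u x - c) * dpart b u x"
proof -
  have "((\<lambda>x. u x - c) has_derivative frechet_derivative u (at x)) (at x)"
    using has_derivative_diff[OF differentiable_on_open_has_derivative[OF assms(1-3)] has_derivative_const[of c]]
    by simp
  from has_derivative_real_comp[where u = "\<lambda>x. u x - c", OF smooth_pos_has_derivative[OF assms(4)] this]
  show ?thesis by (rule dpart_eqI)
qed

text \<open>The squares of the rescaled functions have summable weighted integrals; positivity of the weight
  turns the resulting a.e. convergence of the integrands into that of the functions.\<close>
lemma L2_fast_convergence_AE:
  assumes Om: "open Om" and w: "weight_fun Om w"
    and m: "\<And>n. U n \<in> borel_measurable (lebesgue_on Om)"
    and le: "\<And>n. L2_norm2 Om w (U n) \<le> ennreal ((1 / 2) ^ n / (real (Suc n))\<^sup>2)"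
  shows "AE x in lebesgue_on Om. (\<lambda>n. real (Suc n) * \<bar>U n x\<bar>) \<longlonglongrightarrow> 0"
proof -
  note [measurable] = m weight_fun_measurable[OF Om w]
  have "AE x in lebesgue_on Om. (\<lambda>n. (real (Suc n))\<^sup>2 * ((U n x)\<^sup>2 * w x)) \<longlonglongrightarrow> 0"
  proof (rule AE_summable_tendsto_0)
    show "0 \<le> (real (Suc n))\<^sup>2 * ((U n x)\<^sup>2 * w x)" if "x \<in> space (lebesgue_on Om)" for n x
      using weight_fun_pos[OF w, of x] that by (simp add: less_imp_le)
    show "(\<integral>\<^sup>+x. ennreal ((real (Suc n))\<^sup>2 * ((U n x)\<^sup>2 * w x)) \<partial>lebesgue_on Om) \<le> ennreal ((1 / 2) ^ n)" for n
    proof -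
      have "(\<integral>\<^sup>+x. ennreal ((real (Suc n))\<^sup>2 * ((U n x)\<^sup>2 * w x)) \<partial>lebesgue_on Om)
        = ennreal ((real (Suc n))\<^sup>2) * L2_norm2 Om w (U n)"
        unfolding L2_norm2_def by (subst nn_integral_cmult[symmetric]) (auto simp: ennreal_mult')
      also have "\<dots> \<le> ennreal ((real (Suc n))\<^sup>2) * ennreal ((1 / 2) ^ n / (real (Suc n))\<^sup>2)"
        by (intro mult_left_mono le) auto
      also have "\<dots> = ennreal ((1 / 2) ^ n)"
        by (simp add: ennreal_mult'[symmetric] del: of_nat_Suc)
      finally show ?thesis .
    qed
  qed (auto intro: summable_geometric)
  then show ?thesis
    using AE_space
  proof eventually_elim
    case (elim x)
    then have w0: "w x > 0" using weight_fun_pos[OF w] by simp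
    have "(\<lambda>n. (real (Suc n))\<^sup>2 * ((U n x)\<^sup>2 * w x) * (1 / w x)) \<longlonglongrightarrow> 0 * (1 / w x)"
      by (intro tendsto_mult elim tendsto_const)
    then have "(\<lambda>n. (real (Suc n) * U n x)\<^sup>2) \<longlonglongrightarrow> 0"
      using w0 by (simp add: power_mult_distrib del: of_nat_Suc)
    then have "(\<lambda>n. sqrt ((real (Suc n) * U n x)\<^sup>2)) \<longlonglongrightarrow> sqrt 0"
      by (rule tendsto_real_sqrt)
    then show ?case by (simp add: abs_mult del: of_nat_Suc)
  qed
qed

text \<open>The subsequence \<open>r\<close> makes \<open>\<phi> (r n)\<close> converge to \<open>u\<close> so fast that \<open>(n + 1) * |\<phi> (r n) - u|\<close> tends to 0 a.e.
  The slopes of the regularised truncations then converge to the indicator of \<open>{u > c}\<close>.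
  The conclusion exhibits the approximants, not merely membership of the limit, because
  the domination argument has to control their supports.\<close>
lemma H1_approx_pos_part:
  assumes Om: "open Om" and w: "weight_fun Om w10" "weight_fun Om w11"
    and \<phi>: "\<And>n. \<phi> n \<in> test_fun Om S" and u: "u \<in> borel_measurable (lebesgue_on Om)"
    and appr: "H1_approx Om w10 w11 \<phi> u"
  obtains r where "strict_mono r"
    "H1_approx Om w10 w11 (\<lambda>n x. smooth_pos (1 / real (Suc n)) (\<phi> (r n) x - c)) (\<lambda>x. max (u x - c) 0)"
proof -
  have lim: "(\<lambda>n. L2_norm2 Om w10 (\<lambda>x. \<phi> n x - u x)) \<longlonglongrightarrow> 0"
    using appr by (simp add: H1_approx_def)
  obtain r where r: "strict_mono r"
    "\<And>n. L2_norm2 Om w10 (\<lambda>x. \<phi> (r n) x - u x) \<le> ennreal ((1 / 2) ^ n / (real (Suc n))\<^sup>2)"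
    by (rule strict_mono_seq_small[OF lim, of "\<lambda>n. (1 / 2) ^ n / (real (Suc n))\<^sup>2"]) auto
  define e where "e n = 1 / real (Suc n)" for n
  have e: "e n > 0" for n by (simp add: e_def)
  note \<phi>m [measurable] = test_fun_measurable[OF Om \<phi>] and um [measurable] = u
  have lim': "(\<lambda>n. L2_norm2 Om w10 (\<lambda>x. \<phi> (r n) x - u x)) \<longlonglongrightarrow> 0"
    using H1_approx_subseq[OF appr r(1)] by (simp add: H1_approx_def)
  have "(\<lambda>n. L2_norm2 Om w10 (\<lambda>x. smooth_pos (e n) (\<phi> (r n) x - c) - max (u x - c) 0)) \<longlonglongrightarrow> 0"
  proof (rule tendsto_sandwich[OF _ _ tendsto_const])
    show "\<forall>\<^sub>F n in sequentially. L2_norm2 Om w10 (\<lambda>x. smooth_pos (e n) (\<phi> (r n) x - c) - max (u x - c) 0)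
      \<le> 2 * L2_norm2 Om w10 (\<lambda>x. \<phi> (r n) x - u x) + 2 * (L2_norm2 Om w10 (\<lambda>_. 1) * ennreal ((e n)\<^sup>2))"
    proof (intro always_eventually allI)
      fix n
      have "L2_norm2 Om w10 (\<lambda>_. e n) = L2_norm2 Om w10 (\<lambda>_. 1) * ennreal ((e n)\<^sup>2)"
        unfolding L2_norm2_def using weight_fun_measurable[OF Om w(1)]
        by (subst nn_integral_multc[symmetric]) (auto simp: mult.commute ennreal_mult'')
      moreover have "L2_norm2 Om w10 (\<lambda>x. smooth_pos (e n) (\<phi> (r n) x - c) - max (u x - c) 0)
        \<le> 2 * L2_norm2 Om w10 (\<lambda>x. \<phi> (r n) x - u x) + 2 * L2_norm2 Om w10 (\<lambda>_. e n)"
      proof (rule L2_norm2_le_add[OF Om w(1)])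
        fix x
        show "\<bar>smooth_pos (e n) (\<phi> (r n) x - c) - max (u x - c) 0\<bar> \<le> \<bar>\<phi> (r n) x - u x\<bar> + \<bar>e n\<bar>"
          using smooth_pos_approx[OF e[of n], of "\<phi> (r n) x - c"] e[of n] by (auto simp: max_def split: if_splits)
      qed auto
      ultimately show "L2_norm2 Om w10 (\<lambda>x. smooth_pos (e n) (\<phi> (r n) x - c) - max (u x - c) 0)
        \<le> 2 * L2_norm2 Om w10 (\<lambda>x. \<phi> (r n) x - u x) + 2 * (L2_norm2 Om w10 (\<lambda>_. 1) * ennreal ((e n)\<^sup>2))" by simp
    qed
    have "(\<lambda>n. (e n)\<^sup>2) \<longlonglongrightarrow> 0\<^sup>2"
      unfolding e_def by (intro tendsto_power LIMSEQ_Suc[OF lim_1_over_n])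
    then have e0: "(\<lambda>n. ennreal ((e n)\<^sup>2)) \<longlonglongrightarrow> ennreal 0" by (intro tendsto_ennrealI) simp
    have "(\<lambda>n. 2 * L2_norm2 Om w10 (\<lambda>x. \<phi> (r n) x - u x) + 2 * (L2_norm2 Om w10 (\<lambda>_. 1) * ennreal ((e n)\<^sup>2)))
      \<longlonglongrightarrow> 2 * 0 + 2 * (L2_norm2 Om w10 (\<lambda>_. 1) * ennreal 0)"
      using L2_norm2_const_less_top[OF Om w(1), of 1]
      by (intro tendsto_add ennreal_tendsto_cmult lim' e0) auto
    then show "(\<lambda>n. 2 * L2_norm2 Om w10 (\<lambda>x. \<phi> (r n) x - u x) + 2 * (L2_norm2 Om w10 (\<lambda>_. 1) * ennreal ((e n)\<^sup>2)))
      \<longlonglongrightarrow> 0" by simp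
  qed simp
  moreover have "L2_Cauchy Om w11 (\<lambda>n. dpart b (\<lambda>x. smooth_pos (e n) (\<phi> (r n) x - c)))" if b: "b \<in> Basis" for b
  proof -
    have "L2_Cauchy Om w11 (\<lambda>n x. smooth_step (e n) (\<phi> (r n) x - c) * dpart b (\<phi> (r n)) x)"
    proof (rule L2_Cauchy_mult[OF Om w(2), where P = "\<lambda>x. if u x - c > 0 then 1 else 0"])
      show "dpart b (\<phi> (r n)) \<in> borel_measurable (lebesgue_on Om)" for n
        by (rule test_fun_dpart_measurable[OF Om \<phi> b])
      have "smooth_step (e n) \<in> borel_measurable borel" for n
        by (rule borel_measurable_continuous_onI[OF smooth_real_continuous[OF smooth_real_flat_exp[OF e]]])
      then show "(\<lambda>x. smooth_step (e n) (\<phi> (r n) x - c)) \<in> borel_measurable (lebesgue_on Om)" for n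
        by measurable
      show "L2_Cauchy Om w11 (\<lambda>n. dpart b (\<phi> (r n)))"
        using H1_approx_subseq[OF appr r(1)] b by (simp add: H1_approx_def)
      show "L2_norm2 Om w11 (dpart b (\<phi> (r n))) < \<infinity>" for n
        by (rule L2_norm2_test_fun_less_top[OF Om w(2) test_fun_dpart[OF Om \<phi> b]])
      show "\<bar>smooth_step (e n) (\<phi> (r n) x - c)\<bar> \<le> 1" for n x
        by (rule smooth_step_bounds[OF e])
      have "AE x in lebesgue_on Om. (\<lambda>n. real (Suc n) * \<bar>\<phi> (r n) x - u x\<bar>) \<longlonglongrightarrow> 0"
        by (rule L2_fast_convergence_AE[OF Om w(1) _ r(2)]) measurable
      then show "AE x in lebesgue_on Om. (\<lambda>n. smooth_step (e n) (\<phi> (r n) x - c)) \<longlonglongrightarrow> (if u x - c > 0 then 1 else 0)"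
      proof eventually_elim
        case (elim x)
        then show ?case
          unfolding e_def by (intro smooth_step_tendsto) simp
      qed
    qed auto
    moreover have "L2_norm2 Om w11 (\<lambda>x. dpart b (\<lambda>x. smooth_pos (e m) (\<phi> (r m) x - c)) x
          - dpart b (\<lambda>x. smooth_pos (e n) (\<phi> (r n) x - c)) x)
      = L2_norm2 Om w11 (\<lambda>x. smooth_step (e m) (\<phi> (r m) x - c) * dpart b (\<phi> (r m)) x
          - smooth_step (e n) (\<phi> (r n) x - c) * dpart b (\<phi> (r n)) x)" for m n
      by (rule L2_norm2_cong) (simp add: dpart_smooth_pos[OF Om test_fun_differentiable[OF \<phi>] _ e])
    ultimately show ?thesis by (simp add: L2_Cauchy_def)
  qed
  ultimately show ?thesis
    by (intro that[OF r(1)]) (simp add: H1_approx_def e_def)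
qed

lemma H1_approx_diff:
  assumes Om: "open Om" and w: "weight_fun Om w10" "weight_fun Om w11"
    and t: "\<And>n. \<phi> n \<in> test_fun Om S" "\<And>n. \<psi> n \<in> test_fun Om S"
    and m: "u \<in> borel_measurable (lebesgue_on Om)" "v \<in> borel_measurable (lebesgue_on Om)"
    and appr: "H1_approx Om w10 w11 \<phi> u" "H1_approx Om w10 w11 \<psi> v"
  shows "H1_approx Om w10 w11 (\<lambda>n x. \<phi> n x - \<psi> n x) (\<lambda>x. u x - v x)"
proof -
  have "(\<lambda>n. L2_norm2 Om w10 (\<lambda>x. (\<phi> n x - \<psi> n x) - (u x - v x))) \<longlonglongrightarrow> 0"
  proof (rule tendsto_sandwich[OF _ _ tendsto_const])
    show "\<forall>\<^sub>F n in sequentially. L2_norm2 Om w10 (\<lambda>x. (\<phi> n x - \<psi> n x) - (u x - v x))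
      \<le> 2 * L2_norm2 Om w10 (\<lambda>x. \<phi> n x - u x) + 2 * L2_norm2 Om w10 (\<lambda>x. \<psi> n x - v x)"
      using m test_fun_measurable[OF Om t(1)] test_fun_measurable[OF Om t(2)]
      by (intro always_eventually allI L2_norm2_le_add[OF Om w(1)]) auto
    have "(\<lambda>n. 2 * L2_norm2 Om w10 (\<lambda>x. \<phi> n x - u x) + 2 * L2_norm2 Om w10 (\<lambda>x. \<psi> n x - v x)) \<longlonglongrightarrow> 2 * 0 + 2 * 0"
      using appr by (intro tendsto_add ennreal_tendsto_cmult) (auto simp: H1_approx_def)
    then show "(\<lambda>n. 2 * L2_norm2 Om w10 (\<lambda>x. \<phi> n x - u x) + 2 * L2_norm2 Om w10 (\<lambda>x. \<psi> n x - v x)) \<longlonglongrightarrow> 0"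
      by simp
  qed simp
  moreover have "L2_Cauchy Om w11 (\<lambda>n. dpart b (\<lambda>x. \<phi> n x - \<psi> n x))" if b: "b \<in> Basis" for b
  proof -
    have "L2_Cauchy Om w11 (\<lambda>n x. dpart b (\<phi> n) x - dpart b (\<psi> n) x)"
      using appr b unfolding H1_approx_def
      by (intro L2_Cauchy_diff[OF Om w(2)] test_fun_dpart_measurable[OF Om t(1) b] test_fun_dpart_measurable[OF Om t(2) b]) auto
    moreover have "L2_norm2 Om w11 (\<lambda>x. dpart b (\<lambda>x. \<phi> m x - \<psi> m x) x - dpart b (\<lambda>x. \<phi> n x - \<psi> n x) x)
      = L2_norm2 Om w11 (\<lambda>x. (dpart b (\<phi> m) x - dpart b (\<psi> m) x) - (dpart b (\<phi> n) x - dpart b (\<psi> n) x))" for m n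
      by (rule L2_norm2_cong)
        (simp add: dpart_diff[OF Om test_fun_differentiable[OF t(1)] test_fun_differentiable[OF t(2)]])
    ultimately show ?thesis by (simp add: L2_Cauchy_def)
  qed
  ultimately show ?thesis by (simp add: H1_approx_def)
qed

text \<open>For \<open>c \<ge> 0\<close> the truncated approximants vanish wherever \<open>\<phi> n\<close> does, so they are test functions with
  the same supports.\<close>
lemma H1_closure_pos_part:
  assumes Om: "open Om" and w: "weight_fun Om w10" "weight_fun Om w11"
    and u: "u \<in> H1_closure Om w10 w11 (test_fun Om S)" and c: "c \<ge> 0"
  shows "(\<lambda>x. max (u x - c) 0) \<in> H1_closure Om w10 w11 (test_fun Om S)"
proof -
  from u obtain \<phi> where m: "u \<in> borel_measurable (lebesgue_on Om)"
    and \<phi>: "\<And>n. \<phi> n \<in> test_fun Om S" "H1_approx Om w10 w11 \<phi> u"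
    by (auto simp: H1_closure_iff[OF Om w])
  obtain r where "H1_approx Om w10 w11 (\<lambda>n x. smooth_pos (1 / real (Suc n)) (\<phi> (r n) x - c)) (\<lambda>x. max (u x - c) 0)"
    using H1_approx_pos_part[OF Om w \<phi>(1) m \<phi>(2)] by blast
  then show ?thesis
    unfolding H1_closure_iff[OF Om w] using m \<phi>(1) c
    by (auto intro!: test_fun_smooth_pos[OF Om] exI[of _ "\<lambda>n x. smooth_pos (1 / real (Suc n)) (\<phi> (r n) x - c)"])
qed

text \<open>Write \<open>z = d - (d - z)\<^sup>+\<close> and approximate both positive parts \<open>z = z\<^sup>+\<close> and \<open>(d - z)\<^sup>+\<close> by regularised
  truncations, \<open>\<eta>\<close> and \<open>\<kappa>\<close> below. The approximants \<open>\<delta> - \<kappa>\<close> have the smaller support: where \<open>\<delta>\<close>, the approximant of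
  \<open>d\<close>, vanishes, the argument \<open>\<delta> - \<eta>\<close> of the regularisation is \<open>\<le> 0\<close> because \<open>\<eta> \<ge> 0\<close>, hence \<open>\<kappa> = 0\<close>.
  Truncating \<open>z\<close> first, although \<open>z\<close> is nonnegative already, is what makes its approximants nonnegative.\<close>
lemma wH10_dominated:
  assumes Om: "open Om" and w: "weight_fun Om w10" "weight_fun Om w11"
    and Sg: "openin (top_of_set (frontier Om)) Sg"
    and z: "z \<in> wH1 Om w10 w11" and d: "d \<in> wH10 Om w10 w11 Sg"
    and le: "\<And>x. 0 \<le> z x" "\<And>x. z x \<le> d x"
  shows "z \<in> wH10 Om w10 w11 Sg"
proof -
  let ?S = "frontier Om"
  from z obtain \<zeta> where zm: "z \<in> borel_measurable (lebesgue_on Om)"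
    and \<zeta>: "\<And>n. \<zeta> n \<in> test_fun Om ?S" "H1_approx Om w10 w11 \<zeta> z"
    by (auto simp: wH1_def H1_closure_iff[OF Om w])
  from d obtain \<delta> where dm: "d \<in> borel_measurable (lebesgue_on Om)"
    and \<delta>: "\<And>n. \<delta> n \<in> test_fun Om Sg" "H1_approx Om w10 w11 \<delta> d"
    by (auto simp: wH10_def H1_closure_iff[OF Om w])
  have \<delta>': "\<delta> n \<in> test_fun Om ?S" for n using \<delta>(1) test_fun_subset[OF Om Sg] by blast
  obtain r where r: "strict_mono r"
    and r': "H1_approx Om w10 w11 (\<lambda>n x. smooth_pos (1 / real (Suc n)) (\<zeta> (r n) x - 0)) (\<lambda>x. max (z x - 0) 0)"
    using H1_approx_pos_part[OF Om w \<zeta>(1) zm \<zeta>(2)] by blast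
  define \<eta> where "\<eta> n x = smooth_pos (1 / real (Suc n)) (\<zeta> (r n) x - 0)" for n x
  have \<eta>: "\<eta> n \<in> test_fun Om ?S" for n
    unfolding \<eta>_def by (rule test_fun_smooth_pos[OF Om \<zeta>(1)]) auto
  have \<eta>0: "0 \<le> \<eta> n x" for n x by (simp add: \<eta>_def smooth_pos_nonneg)
  have "H1_approx Om w10 w11 \<eta> z"
    using r' le(1) by (simp add: \<eta>_def[abs_def] max_absorb1)
  then have diff: "H1_approx Om w10 w11 (\<lambda>n x. \<delta> n x - \<eta> n x) (\<lambda>x. d x - z x)"
    by (rule H1_approx_diff[OF Om w \<delta>' \<eta> dm zm \<delta>(2)])
  have \<delta>\<eta>: "(\<lambda>x. \<delta> n x - \<eta> n x) \<in> test_fun Om ?S" for n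
    by (rule test_fun_diff[OF Om \<delta>' \<eta>])
  obtain s where s: "strict_mono s" and
    s': "H1_approx Om w10 w11 (\<lambda>n x. smooth_pos (1 / real (Suc n)) (\<delta> (s n) x - \<eta> (s n) x - 0)) (\<lambda>x. max (d x - z x - 0) 0)"
    by (rule H1_approx_pos_part[OF Om w \<delta>\<eta> borel_measurable_diff[OF dm zm] diff, of 0])
  define \<kappa> where "\<kappa> n x = smooth_pos (1 / real (Suc n)) (\<delta> (s n) x - \<eta> (s n) x - 0)" for n x
  have \<kappa>: "\<kappa> n \<in> test_fun Om ?S" for n
    unfolding \<kappa>_def by (rule test_fun_smooth_pos[OF Om \<delta>\<eta>]) auto
  have "H1_approx Om w10 w11 \<kappa> (\<lambda>x. d x - z x)"
    using s' le(2) by (simp add: \<kappa>_def[abs_def] max_absorb1)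
  then have "H1_approx Om w10 w11 (\<lambda>n x. \<delta> (s n) x - \<kappa> n x) (\<lambda>x. d x - (d x - z x))"
    using dm zm by (intro H1_approx_diff[OF Om w \<delta>' \<kappa>] H1_approx_subseq[OF \<delta>(2) s]) auto
  moreover have "(\<lambda>x. \<delta> (s n) x - \<kappa> n x) \<in> test_fun Om Sg" for n
  proof -
    obtain T where T: "smooth_up_to Om Sg (\<delta> (s n))" "\<And>x. x \<in> Om \<Longrightarrow> x \<notin> T \<Longrightarrow> \<delta> (s n) x = 0"
      "compact T" "T \<subseteq> Om \<union> Sg"
      using \<delta>(1)[of "s n"] by (rule test_funE) blast
    have "smooth_up_to Om ?S (\<kappa> n)" using \<kappa>[of n] by (simp add: test_fun_def)
    then have "smooth_up_to Om Sg (\<kappa> n)"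
      using openin_imp_subset[OF Sg] by (rule smooth_up_to_mono)
    then have "smooth_up_to Om Sg (\<lambda>x. \<delta> (s n) x - \<kappa> n x)"
      by (rule smooth_up_to_diff[OF Om T(1)])
    then show ?thesis
      by (rule test_funI[OF _ _ T(3,4)]) (use T(2) \<eta>0 in \<open>simp add: \<kappa>_def smooth_pos_eq_0\<close>)
  qed
  ultimately show ?thesis
    unfolding wH10_def H1_closure_iff[OF Om w] using zm
    by (auto intro!: exI[of _ "\<lambda>n x. \<delta> (s n) x - \<kappa> n x"])
qed

section \<open>Weighted inner products and essential bounds\<close>

lemma wL2_norm_less_top:
  assumes Om: "open Om" and w: "weight_fun Om w" and f: "f \<in> wL2 Om w"
  shows "L2_norm2 Om w f < \<infinity>"
proof -
  from f obtain \<phi> where m: "f \<in> borel_measurable (lebesgue_on Om)"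
    and \<phi>: "\<And>n. \<phi> n \<in> test_fun Om (frontier Om)"
    and lim: "(\<lambda>n. L2_norm2 Om w (\<lambda>x. \<phi> n x - f x)) \<longlonglongrightarrow> 0"
    by (auto simp: wL2_def)
  obtain n where n: "L2_norm2 Om w (\<lambda>x. \<phi> n x - f x) < 1"
    using order_tendstoD(2)[OF lim, of 1] by (auto simp: eventually_sequentially)
  have "L2_norm2 Om w f \<le> 2 * L2_norm2 Om w (\<lambda>x. \<phi> n x - f x) + 2 * L2_norm2 Om w (\<phi> n)"
    using m test_fun_measurable[OF Om \<phi>] by (intro L2_norm2_le_add[OF Om w]) auto
  also have "\<dots> < \<infinity>"
    using L2_norm2_test_fun_less_top[OF Om w \<phi>, of n] order.strict_trans[OF n ennreal_one_less_top]
    by (simp add: ennreal_mult_less_top)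
  finally show ?thesis .
qed

lemma wL2_measurable: "f \<in> wL2 Om w \<Longrightarrow> f \<in> borel_measurable (lebesgue_on Om)"
  by (simp add: wL2_def)

lemma wL2_inner_integrable:
  assumes Om: "open Om" and w: "weight_fun Om w"
    and m: "f \<in> borel_measurable (lebesgue_on Om)" "g \<in> borel_measurable (lebesgue_on Om)"
    and fin: "L2_norm2 Om w f < \<infinity>" "L2_norm2 Om w g < \<infinity>"
  shows "integrable (lebesgue_on Om) (\<lambda>x. f x * g x * w x)"
proof (rule integrableI_bounded)
  note [measurable] = m weight_fun_measurable[OF Om w]
  show "(\<lambda>x. f x * g x * w x) \<in> borel_measurable (lebesgue_on Om)" by measurable
  have "(\<integral>\<^sup>+x. ennreal (norm (f x * g x * w x)) \<partial>lebesgue_on Om)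
    \<le> (\<integral>\<^sup>+x. ennreal ((f x)\<^sup>2 * w x) + ennreal ((g x)\<^sup>2 * w x) \<partial>lebesgue_on Om)"
  proof (rule nn_integral_mono)
    fix x assume "x \<in> space (lebesgue_on Om)"
    then have x: "w x > 0" using weight_fun_pos[OF w] by simp
    have "\<bar>f x * g x\<bar> \<le> (f x)\<^sup>2 + (g x)\<^sup>2"
      using sum_squares_bound[of "\<bar>f x\<bar>" "\<bar>g x\<bar>"] mult_nonneg_nonneg[of "\<bar>f x\<bar>" "\<bar>g x\<bar>"]
      unfolding abs_mult power2_abs by linarith
    then have "\<bar>f x * g x\<bar> * w x \<le> ((f x)\<^sup>2 + (g x)\<^sup>2) * w x"
      using x by (intro mult_right_mono) auto
    then show "ennreal (norm (f x * g x * w x)) \<le> ennreal ((f x)\<^sup>2 * w x) + ennreal ((g x)\<^sup>2 * w x)"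
      using x by (simp add: abs_mult distrib_right flip: ennreal_plus)
  qed
  also have "\<dots> = L2_norm2 Om w f + L2_norm2 Om w g"
    unfolding L2_norm2_def by (rule nn_integral_add) auto
  also have "\<dots> < \<infinity>" using fin by simp
  finally show "(\<integral>\<^sup>+x. ennreal (norm (f x * g x * w x)) \<partial>lebesgue_on Om) < \<infinity>" .
qed

lemma ereal_le_enn2ereal_e2ennreal: "x \<le> enn2ereal (e2ennreal x)"
proof (cases "0 \<le> x")
  case False
  then have "x \<le> 0" by simp
  also have "0 \<le> enn2ereal (e2ennreal x)" by simp
  finally show ?thesis .
qed (simp add: enn2ereal_e2ennreal)

lemma ess_sup_on_le_Linf_norm:
  assumes "f \<in> borel_measurable (lebesgue_on Om)"
  shows "ess_sup_on Om f \<le> enn2ereal (Linf_norm Om f)"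
  unfolding ess_sup_on_def
proof (rule esssup_I)
  show "(\<lambda>x. ereal (f x)) \<in> borel_measurable (lebesgue_on Om)" using assms by simp
  have "AE x in lebesgue_on Om. ennreal \<bar>f x\<bar> \<le> Linf_norm Om f"
    unfolding Linf_norm_def by (rule esssup_AE)
  then show "AE x in lebesgue_on Om. ereal (f x) \<le> enn2ereal (Linf_norm Om f)"
  proof eventually_elim
    case (elim x)
    have "ereal (f x) \<le> ereal \<bar>f x\<bar>" by simp
    also have "\<dots> = enn2ereal (ennreal \<bar>f x\<bar>)" by (simp add: enn2ereal_ennreal)
    also have "\<dots> \<le> enn2ereal (Linf_norm Om f)" using elim by (simp add: less_eq_ennreal.rep_eq)
    finally show ?case .
  qed
qed

lemma Linf_norm_le:
  assumes "u \<in> borel_measurable (lebesgue_on Om)"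
    and "AE x in lebesgue_on Om. ereal (u x) \<le> M" "AE x in lebesgue_on Om. ereal (- u x) \<le> M'"
    and "M \<le> enn2ereal C" "M' \<le> enn2ereal C"
  shows "Linf_norm Om u \<le> C"
  unfolding Linf_norm_def
proof (rule esssup_I)
  show "(\<lambda>x. ennreal \<bar>u x\<bar>) \<in> borel_measurable (lebesgue_on Om)" using assms(1) by simp
  show "AE x in lebesgue_on Om. ennreal \<bar>u x\<bar> \<le> C"
    using assms(2,3)
  proof eventually_elim
    case (elim x)
    then have "ereal (u x) \<le> enn2ereal C" "ereal (- u x) \<le> enn2ereal C"
      using assms(4,5) by (auto intro: order_trans)
    then have "ereal \<bar>u x\<bar> \<le> enn2ereal C" by (auto simp: abs_if)
    then show ?case by (simp add: less_eq_ennreal.rep_eq enn2ereal_ennreal)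
  qed
qed

section \<open>Upper bounds from the weak maximum principle\<close>

locale weak_max_form =
  fixes Om Sg :: "'a::euclidean_space set"
    and w00 w10 w11 :: "'a \<Rightarrow> real"
    and a :: "('a \<Rightarrow> real) \<Rightarrow> ('a \<Rightarrow> real) \<Rightarrow> real"
    and K :: "('a \<Rightarrow> real) set"
  assumes Om: "open Om"
    and w00: "weight_fun Om w00" and w10: "weight_fun Om w10" and w11: "weight_fun Om w11"
    and H1_L2: "wH1 Om w10 w11 \<subseteq> wL2 Om w00"
    and Sg: "openin (top_of_set (frontier Om)) Sg"
    and bilinear: "bilinear_map_on Om (wH1 Om w10 w11) a"
    and cone: "convex_cone_in Om (wH1 Om w10 w11) K"
    and one_in_K: "(\<lambda>_. 1) \<in> K" and minus_one_in_K: "(\<lambda>_. - 1) \<in> K"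
    and wmp: "weak_max_principle Om w10 w11 Sg K a"
    and a_one_nonneg: "\<And>\<phi>. \<phi> \<in> wH10_nonneg Om w10 w11 Sg \<Longrightarrow> a (\<lambda>_. 1) \<phi> \<ge> 0"
begin

abbreviation "H1 \<equiv> wH1 Om w10 w11"
abbreviation "test_cone \<equiv> wH10_nonneg Om w10 w11 Sg"

abbreviation bdry_bound :: "('a \<Rightarrow> real) \<Rightarrow> ereal" where
  "bdry_bound u \<equiv> (if Sg = frontier Om then - \<infinity> else bdry_sup Om w10 w11 Sg u)"

lemma K_subset: "u \<in> K \<Longrightarrow> u \<in> H1"
  using cone by (auto simp: convex_cone_in_def)

lemma K_measurable: "u \<in> K \<Longrightarrow> u \<in> borel_measurable (lebesgue_on Om)"
  using K_subset[of u] by (simp add: wH1_def H1_closure_def)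

lemma wH10_subset: "wH10 Om w10 w11 Sg \<subseteq> H1"
proof
  fix \<phi> assume "\<phi> \<in> wH10 Om w10 w11 Sg"
  then show "\<phi> \<in> H1"
    using subsetD[OF test_fun_subset[OF Om Sg]]
    unfolding wH10_def wH1_def H1_closure_iff[OF Om w10 w11] by meson
qed

lemma test_cone_subset: "\<phi> \<in> test_cone \<Longrightarrow> \<phi> \<in> H1"
  using wH10_subset by (auto simp: wH10_nonneg_def)

lemma a_combination:
  assumes "u \<in> H1" "v \<in> H1" "\<phi> \<in> H1"
  shows "a (\<lambda>x. s * u x + t * v x) \<phi> = s * a u \<phi> + t * a v \<phi>"
  using bilinear assms unfolding bilinear_map_on_def by blast

lemma a_minus: "(\<lambda>x. - v x) \<in> K \<Longrightarrow> \<phi> \<in> H1 \<Longrightarrow> a v \<phi> = - a (\<lambda>x. - v x) \<phi>"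
  using a_combination[of "\<lambda>x. - v x" "\<lambda>x. - v x" \<phi> "- 1" 0] K_subset by simp

lemma K_minus_const:
  assumes "u \<in> K"
  shows "(\<lambda>x. u x - l) \<in> K"
proof -
  have *: "(\<lambda>x. s * u x + t * v x) \<in> K" if "v \<in> K" "s \<ge> 0" "t \<ge> 0" for v s t
    using cone assms that unfolding convex_cone_in_def by blast
  show ?thesis
    using *[OF one_in_K, of 1 "- l"] *[OF minus_one_in_K, of 1 l] by (cases "l \<ge> 0") auto
qed

lemma a_minus_const:
  assumes "u \<in> K" "\<phi> \<in> H1"
  shows "a (\<lambda>x. u x - l) \<phi> = a u \<phi> - l * a (\<lambda>_. 1) \<phi>"
  using a_combination[OF K_subset[OF assms(1)] K_subset[OF one_in_K] assms(2), of 1 "- l"] by simp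

lemma K_pos_part:
  assumes "u \<in> K"
  shows "(\<lambda>x. max (u x - l) 0) \<in> H1"
  using H1_closure_pos_part[OF Om w10 w11, of "\<lambda>x. u x - l" "frontier Om" 0]
    K_subset[OF K_minus_const[OF assms, of l]] by (simp add: wH1_def)

text \<open>Raising the level by \<open>l' - l \<ge> 0\<close> truncates \<open>(u - l)\<^sup>+\<close> once more: \<open>(u - l')\<^sup>+ = ((u - l)\<^sup>+ - (l' - l))\<^sup>+\<close>.\<close>
lemma le_on_bdry_mono:
  assumes "le_on_bdry Om w10 w11 Sg u l" "l \<le> l'"
  shows "le_on_bdry Om w10 w11 Sg u l'"
proof -
  have "max (max (u x - l) 0 - (l' - l)) 0 = max (u x - l') 0" for x
    using assms(2) by (auto simp: max_def)
  then show ?thesis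
    using H1_closure_pos_part[OF Om w10 w11, of "\<lambda>x. max (u x - l) 0" Sg "l' - l"] assms
    by (simp add: le_on_bdry_def wH10_def)
qed

text \<open>When \<open>Sg\<close> is the whole boundary the subspace \<^const>\<open>wH10\<close> is all of \<open>H1\<close>, so every level is admissible.
  This is the sense in which the boundary term may be omitted.\<close>
lemma le_on_bdry_of_bdry_bound:
  assumes "u \<in> K" "bdry_bound u < ereal l"
  shows "le_on_bdry Om w10 w11 Sg u l"
proof (cases "Sg = frontier Om")
  case True
  then have "wH10 Om w10 w11 Sg = H1" by (simp add: wH10_def wH1_def)
  then show ?thesis using K_pos_part[OF assms(1)] by (simp add: le_on_bdry_def)
next
  case False
  with assms(2) obtain l' where "le_on_bdry Om w10 w11 Sg u l'" "l' < l"
    by (auto simp: bdry_sup_def INF_less_iff)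
  then show ?thesis by (auto intro: le_on_bdry_mono)
qed

lemma le_const_of_le_on_bdry:
  assumes u: "u \<in> K" and le: "\<And>\<phi>. \<phi> \<in> test_cone \<Longrightarrow> a u \<phi> \<le> l * a (\<lambda>_. 1) \<phi>"
    and bdry: "le_on_bdry Om w10 w11 Sg u l"
  shows "AE x in lebesgue_on Om. u x \<le> l"
proof -
  have "a (\<lambda>x. u x - l) \<phi> \<le> 0" if "\<phi> \<in> test_cone" for \<phi>
    using le[OF that] a_minus_const[OF u test_cone_subset[OF that]] by simp
  moreover have "le_on_bdry Om w10 w11 Sg (\<lambda>x. u x - l) 0"
    using bdry by (simp add: le_on_bdry_def)
  ultimately have "AE x in lebesgue_on Om. u x - l \<le> 0"
    using wmp K_minus_const[OF u, of l] unfolding weak_max_principle_def by blast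
  then show ?thesis by simp
qed

text \<open>The bound is approached through the levels \<open>M + 1 / (n + 1)\<close>: strictly above \<open>M\<close> there is room for an
  admissible boundary level, whereas \<open>M\<close> itself need not be one.\<close>
lemma upper_bound:
  assumes u: "u \<in> K" and M: "bdry_bound u \<le> M" "0 \<le> M"
    and le: "\<And>l \<phi>. M < ereal l \<Longrightarrow> \<phi> \<in> test_cone \<Longrightarrow> a u \<phi> \<le> l * a (\<lambda>_. 1) \<phi>"
  shows "AE x in lebesgue_on Om. ereal (u x) \<le> M"
proof (cases M)
  case (real m)
  have "AE x in lebesgue_on Om. u x \<le> m + 1 / real (Suc n)" for n
  proof (rule le_const_of_le_on_bdry[OF u])
    have less: "M < ereal (m + 1 / real (Suc n))" using real by simp
    then show "a u \<phi> \<le> (m + 1 / real (Suc n)) * a (\<lambda>_. 1) \<phi>" if "\<phi> \<in> test_cone" for \<phi>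
      using that by (rule le)
    show "le_on_bdry Om w10 w11 Sg u (m + 1 / real (Suc n))"
      by (rule le_on_bdry_of_bdry_bound[OF u le_less_trans[OF M(1) less]])
  qed
  then have "AE x in lebesgue_on Om. \<forall>n. u x \<le> m + 1 / real (Suc n)"
    by (simp add: AE_all_countable)
  then show ?thesis
  proof eventually_elim
    case (elim x)
    have "(\<lambda>n. m + 1 / real (Suc n)) \<longlonglongrightarrow> m + 0"
      by (intro tendsto_intros LIMSEQ_Suc[OF lim_1_over_n])
    then have "u x \<le> m + 0" using elim by (intro LIMSEQ_le_const) auto
    then show ?case using real by simp
  qed
qed (use M(2) in auto)

lemma upper_bound_subsolution:
  assumes "u \<in> K" "\<And>\<phi>. \<phi> \<in> test_cone \<Longrightarrow> a u \<phi> \<le> 0"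
  shows "AE x in lebesgue_on Om. ereal (u x) \<le> max 0 (bdry_bound u)"
proof (rule upper_bound[OF assms(1)])
  fix l \<phi> assume "max 0 (bdry_bound u) < ereal l" and \<phi>: "\<phi> \<in> test_cone"
  then have "0 \<le> l" by (simp add: zero_ereal_def)
  then have "0 \<le> l * a (\<lambda>_. 1) \<phi>" using a_one_nonneg[OF \<phi>] by simp
  then show "a u \<phi> \<le> l * a (\<lambda>_. 1) \<phi>" using assms(2)[OF \<phi>] by simp
qed auto

lemma wL2_inner_le:
  assumes f: "f \<in> borel_measurable (lebesgue_on Om)" "L2_norm2 Om w00 f < \<infinity>"
    and le: "AE x in lebesgue_on Om. f x \<le> l * c" and \<phi>: "\<phi> \<in> test_cone"
  shows "wL2_inner Om w00 f \<phi> \<le> l * wL2_inner Om w00 (\<lambda>_. c) \<phi>"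
proof -
  have \<phi>L: "\<phi> \<in> wL2 Om w00" using H1_L2 test_cone_subset[OF \<phi>] by blast
  note \<phi>' = wL2_measurable[OF \<phi>L] wL2_norm_less_top[OF Om w00 \<phi>L]
  have nn: "AE x in lebesgue_on Om. 0 \<le> \<phi> x" using \<phi> by (simp add: wH10_nonneg_def)
  have "wL2_inner Om w00 f \<phi> \<le> wL2_inner Om w00 (\<lambda>_. l * c) \<phi>"
    unfolding wL2_inner_def
  proof (rule integral_mono_AE)
    show "integrable (lebesgue_on Om) (\<lambda>x. f x * \<phi> x * w00 x)"
      by (rule wL2_inner_integrable[OF Om w00 f(1) \<phi>'(1) f(2) \<phi>'(2)])
    show "integrable (lebesgue_on Om) (\<lambda>x. l * c * \<phi> x * w00 x)"
      by (rule wL2_inner_integrable[OF Om w00 _ \<phi>'(1) L2_norm2_const_less_top[OF Om w00] \<phi>'(2)]) simp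
    show "AE x in lebesgue_on Om. f x * \<phi> x * w00 x \<le> l * c * \<phi> x * w00 x"
      using le nn AE_space
    proof eventually_elim
      case (elim x)
      then show ?case
        using weight_fun_pos[OF w00, of x] by (intro mult_right_mono) (auto simp: less_imp_le)
    qed
  qed
  also have "\<dots> = l * wL2_inner Om w00 (\<lambda>_. c) \<phi>"
    by (simp add: wL2_inner_def mult.assoc)
  finally show ?thesis .
qed

text \<open>For \<open>l\<close> above the bound, \<open>f \<le> l * c0\<close> a.e. and \<open>l \<ge> 0\<close>, so that
  \<open>a u \<phi> \<le> (f, \<phi>) \<le> l * (c0, \<phi>) \<le> l * a 1 \<phi>\<close>.\<close>
lemma upper_bound_inhomogeneous:
  assumes u: "u \<in> K" and c0: "c0 > 0" and P: "condition_P Om w00 w10 w11 Sg a c0"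
    and f: "f \<in> borel_measurable (lebesgue_on Om)" "L2_norm2 Om w00 f < \<infinity>"
    and le: "\<And>\<phi>. \<phi> \<in> test_cone \<Longrightarrow> a u \<phi> \<le> wL2_inner Om w00 f \<phi>"
  shows "AE x in lebesgue_on Om. ereal (u x) \<le> max 0 (max (ereal (1 / c0) * ess_sup_on Om f) (bdry_bound u))"
proof (rule upper_bound[OF u])
  fix l \<phi>
  assume less: "max 0 (max (ereal (1 / c0) * ess_sup_on Om f) (bdry_bound u)) < ereal l"
    and \<phi>: "\<phi> \<in> test_cone"
  then have l: "0 \<le> l" and ess: "ereal (1 / c0) * ess_sup_on Om f < ereal l"
    by (simp_all add: zero_ereal_def)
  have "ess_sup_on Om f \<le> ereal (l * c0)"
    using ess c0 by (cases "ess_sup_on Om f") (auto simp: field_simps)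
  moreover have "AE x in lebesgue_on Om. ereal (f x) \<le> ess_sup_on Om f"
    unfolding ess_sup_on_def by (rule esssup_AE)
  ultimately have "AE x in lebesgue_on Om. f x \<le> l * c0"
    by (auto elim!: eventually_mono dest: order_trans)
  then have "wL2_inner Om w00 f \<phi> \<le> l * wL2_inner Om w00 (\<lambda>_. c0) \<phi>"
    by (rule wL2_inner_le[OF f _ \<phi>])
  also have "\<dots> \<le> l * a (\<lambda>_. 1) \<phi>"
    using P \<phi> l by (intro mult_left_mono) (auto simp: condition_P_def)
  finally show "a u \<phi> \<le> l * a (\<lambda>_. 1) \<phi>"
    using le[OF \<phi>] by simp
qed (intro max.coboundedI2 order_refl, simp)

text \<open>Every level admissible for \<open>|u|\<close> is admissible for \<open>u\<close>, by domination of \<open>(u - l)\<^sup>+\<close> by \<open>(|u| - l)\<^sup>+\<close>.\<close>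
lemma bdry_sup_le_abs:
  assumes "u \<in> K"
  shows "bdry_sup Om w10 w11 Sg u \<le> bdry_sup Om w10 w11 Sg (\<lambda>x. \<bar>u x\<bar>)"
proof -
  have "le_on_bdry Om w10 w11 Sg u l" if "le_on_bdry Om w10 w11 Sg (\<lambda>x. \<bar>u x\<bar>) l" for l
    unfolding le_on_bdry_def
    by (rule wH10_dominated[OF Om w10 w11 Sg K_pos_part[OF assms] that[unfolded le_on_bdry_def]])
      (auto simp: max_def)
  then show ?thesis
    unfolding bdry_sup_def by (intro INF_superset_mono) auto
qed

lemma bdry_bound_le_norm:
  assumes "u \<in> K"
  shows "bdry_bound u \<le> enn2ereal (if Sg = frontier Om then 0 else bdry_Linf_norm Om w10 w11 Sg u)"
  using order_trans[OF bdry_sup_le_abs[OF assms] ereal_le_enn2ereal_e2ennreal]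
  by (simp add: bdry_Linf_norm_def)

end

section \<open>A priori estimates\<close>

theorem proposition6p5:
  fixes Om Sg :: "'a::euclidean_space set"
    and w00 w10 w11 :: "'a \<Rightarrow> real"
    and a :: "('a \<Rightarrow> real) \<Rightarrow> ('a \<Rightarrow> real) \<Rightarrow> real"
    and K :: "('a \<Rightarrow> real) set"
    and u v f :: "'a \<Rightarrow> real"
  assumes "open Om"
    and "weight_fun Om w00" and "weight_fun Om w10" and "weight_fun Om w11"
    and "H1_in_L2_continuous Om w00 w10 w11"
    and "openin (top_of_set (frontier Om)) Sg"
    and "bilinear_map_on Om (wH1 Om w10 w11) a"
    and "convex_cone_in Om (wH1 Om w10 w11) K"
    and "(\<lambda>_. 1) \<in> K" and "(\<lambda>_. - 1) \<in> K"
    and "weak_max_principle Om w10 w11 Sg K a"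
    and "\<forall>\<phi>\<in>wH10_nonneg Om w10 w11 Sg. a (\<lambda>_. 1) \<phi> \<ge> 0"
    and "u \<in> K" and "(\<lambda>x. - v x) \<in> K"
    and "f \<in> wL2 Om w00"
  shows
    "((\<forall>\<phi>\<in>wH10_nonneg Om w10 w11 Sg. a u \<phi> \<le> 0) \<longrightarrow>
        (AE x in lebesgue_on Om. ereal (u x) \<le>
           max 0 (if Sg = frontier Om then - \<infinity> else bdry_sup Om w10 w11 Sg u)))
     \<and> (\<forall>c0>0. condition_P Om w00 w10 w11 Sg a c0 \<longrightarrow>
        (\<forall>\<phi>\<in>wH10_nonneg Om w10 w11 Sg. a u \<phi> \<le> wL2_inner Om w00 f \<phi>) \<longrightarrow>
        (AE x in lebesgue_on Om. ereal (u x) \<le>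
           max 0 (max (ereal (1 / c0) * ess_sup_on Om f)
             (if Sg = frontier Om then - \<infinity> else bdry_sup Om w10 w11 Sg u))))
     \<and> ((\<forall>\<phi>\<in>wH10_nonneg Om w10 w11 Sg. a v \<phi> \<ge> 0) \<longrightarrow>
        (AE x in lebesgue_on Om. ereal (v x) \<ge>
           min 0 (if Sg = frontier Om then \<infinity> else bdry_inf Om w10 w11 Sg v)))
     \<and> (\<forall>c0>0. condition_P Om w00 w10 w11 Sg a c0 \<longrightarrow>
        (\<forall>\<phi>\<in>wH10_nonneg Om w10 w11 Sg. a v \<phi> \<ge> wL2_inner Om w00 f \<phi>) \<longrightarrow>
        (AE x in lebesgue_on Om. ereal (v x) \<ge>
           min 0 (min (ereal (1 / c0) * ess_inf_on Om f)
             (if Sg = frontier Om then \<infinity> else bdry_inf Om w10 w11 Sg v))))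
     \<and> ((\<lambda>x. - u x) \<in> K \<longrightarrow>
        (\<forall>\<phi>\<in>wH10 Om w10 w11 Sg. a u \<phi> = 0) \<longrightarrow>
        Linf_norm Om u \<le> (if Sg = frontier Om then 0 else bdry_Linf_norm Om w10 w11 Sg u))
     \<and> (\<forall>c0>0. condition_P Om w00 w10 w11 Sg a c0 \<longrightarrow>
        (\<lambda>x. - u x) \<in> K \<longrightarrow>
        (\<forall>\<phi>\<in>wH10 Om w10 w11 Sg. a u \<phi> = wL2_inner Om w00 f \<phi>) \<longrightarrow>
        Linf_norm Om u \<le>
           max (ennreal (1 / c0) * Linf_norm Om f)
             (if Sg = frontier Om then 0 else bdry_Linf_norm Om w10 w11 Sg u))"
proof -
  interpret weak_max_form Om Sg w00 w10 w11 a K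
    using assms by unfold_locales (auto simp: H1_in_L2_continuous_def)
  note uK = \<open>u \<in> K\<close> and vK = \<open>(\<lambda>x. - v x) \<in> K\<close>
  have fm: "f \<in> borel_measurable (lebesgue_on Om)" "(\<lambda>x. - f x) \<in> borel_measurable (lebesgue_on Om)"
    using wL2_measurable[OF assms(15)] by auto
  have ff: "L2_norm2 Om w00 f < \<infinity>" "L2_norm2 Om w00 (\<lambda>x. - f x) < \<infinity>"
    using wL2_norm_less_top[OF assms(1,2,15)] by (simp_all add: L2_norm2_def)
  have inner_minus: "wL2_inner Om w00 (\<lambda>x. - f x) \<phi> = - wL2_inner Om w00 f \<phi>" for \<phi>
    by (simp add: wL2_inner_def)
  \<comment> \<open>Upper bounds for \<open>- v\<close> read as lower bounds for \<open>v\<close>, including the omitted boundary term.\<close>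
  have lower: "ereal (- r) \<le> max 0 (if Sg = frontier Om then - \<infinity> else b) \<longleftrightarrow>
      min 0 (if Sg = frontier Om then \<infinity> else - b) \<le> ereal r" for r b
    by (cases b) (auto simp: min_def max_def zero_ereal_def)
  have lower2: "ereal (- r) \<le> max 0 (max e (if Sg = frontier Om then - \<infinity> else b)) \<longleftrightarrow>
      min 0 (min (- e) (if Sg = frontier Om then \<infinity> else - b)) \<le> ereal r" for r b e
    by (cases b; cases e) (auto simp: min_def max_def zero_ereal_def)
  have one: "AE x in lebesgue_on Om. ereal (u x) \<le> max 0 (bdry_bound u)"
    if "\<forall>\<phi>\<in>test_cone. a u \<phi> \<le> 0"
    using upper_bound_subsolution[OF uK] that by blast
  have two: "AE x in lebesgue_on Om. ereal (u x) \<le> max 0 (max (ereal (1 / c0) * ess_sup_on Om f) (bdry_bound u))"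
    if "c0 > 0" "condition_P Om w00 w10 w11 Sg a c0" "\<forall>\<phi>\<in>test_cone. a u \<phi> \<le> wL2_inner Om w00 f \<phi>" for c0
    using upper_bound_inhomogeneous[OF uK that(1,2) fm(1) ff(1)] that(3) by blast
  have three: "AE x in lebesgue_on Om. min 0 (if Sg = frontier Om then \<infinity> else bdry_inf Om w10 w11 Sg v) \<le> ereal (v x)"
    if "\<forall>\<phi>\<in>test_cone. a v \<phi> \<ge> 0"
  proof -
    have "AE x in lebesgue_on Om. ereal (- v x) \<le> max 0 (bdry_bound (\<lambda>x. - v x))"
      using that a_minus[OF vK test_cone_subset] by (intro upper_bound_subsolution[OF vK]) fastforce
    then show ?thesis unfolding lower bdry_inf_def .
  qed
  have four: "AE x in lebesgue_on Om. min 0 (min (ereal (1 / c0) * ess_inf_on Om f)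
      (if Sg = frontier Om then \<infinity> else bdry_inf Om w10 w11 Sg v)) \<le> ereal (v x)"
    if "c0 > 0" "condition_P Om w00 w10 w11 Sg a c0" "\<forall>\<phi>\<in>test_cone. a v \<phi> \<ge> wL2_inner Om w00 f \<phi>" for c0
  proof -
    have "AE x in lebesgue_on Om. ereal (- v x) \<le>
        max 0 (max (ereal (1 / c0) * ess_sup_on Om (\<lambda>x. - f x)) (bdry_bound (\<lambda>x. - v x)))"
      using that(3) a_minus[OF vK test_cone_subset]
      by (intro upper_bound_inhomogeneous[OF vK that(1,2) fm(2) ff(2)]) (fastforce simp: inner_minus)
    then show ?thesis unfolding lower2 bdry_inf_def ess_inf_on_def ereal_mult_minus_right .
  qed
  let ?B = "if Sg = frontier Om then 0 else bdry_Linf_norm Om w10 w11 Sg u"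
  have minus_bound: "bdry_bound (\<lambda>x. - u x) \<le> enn2ereal ?B" if "(\<lambda>x. - u x) \<in> K"
    using bdry_bound_le_norm[OF that] by (cases "Sg = frontier Om") (simp_all add: bdry_Linf_norm_def)
  have nonneg_sub: "test_cone \<subseteq> wH10 Om w10 w11 Sg" by (auto simp: wH10_nonneg_def)
  have five: "Linf_norm Om u \<le> ?B"
    if mK: "(\<lambda>x. - u x) \<in> K" and eq: "\<forall>\<phi>\<in>wH10 Om w10 w11 Sg. a u \<phi> = 0"
  proof (rule Linf_norm_le[OF K_measurable[OF uK]])
    show "AE x in lebesgue_on Om. ereal (u x) \<le> max 0 (bdry_bound u)"
      using eq nonneg_sub by (intro one) auto
    show "AE x in lebesgue_on Om. ereal (- u x) \<le> max 0 (bdry_bound (\<lambda>x. - u x))"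
      using eq nonneg_sub a_minus[OF mK test_cone_subset]
      by (intro upper_bound_subsolution[OF mK]) fastforce
    show "max 0 (bdry_bound u) \<le> enn2ereal ?B"
      by (intro max.boundedI bdry_bound_le_norm[OF uK]) simp
    show "max 0 (bdry_bound (\<lambda>x. - u x)) \<le> enn2ereal ?B"
      by (intro max.boundedI minus_bound[OF mK]) simp
  qed
  have six: "Linf_norm Om u \<le> max (ennreal (1 / c0) * Linf_norm Om f) ?B"
    if c0: "c0 > 0" and P: "condition_P Om w00 w10 w11 Sg a c0"
      and mK: "(\<lambda>x. - u x) \<in> K" and eq: "\<forall>\<phi>\<in>wH10 Om w10 w11 Sg. a u \<phi> = wL2_inner Om w00 f \<phi>" for c0
  proof (rule Linf_norm_le[OF K_measurable[OF uK]])
    let ?C = "max (ennreal (1 / c0) * Linf_norm Om f) ?B"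
    have C: "enn2ereal (ennreal (1 / c0) * Linf_norm Om f) \<le> enn2ereal ?C" "enn2ereal ?B \<le> enn2ereal ?C"
      by (simp_all add: less_eq_ennreal.rep_eq[symmetric])
    have ess: "ereal (1 / c0) * ess_sup_on Om g \<le> enn2ereal ?C"
      if "g \<in> borel_measurable (lebesgue_on Om)" "Linf_norm Om g = Linf_norm Om f" for g
    proof -
      have "ereal (1 / c0) * ess_sup_on Om g \<le> ereal (1 / c0) * enn2ereal (Linf_norm Om f)"
        using ess_sup_on_le_Linf_norm[OF that(1)] that(2) c0 by (intro ereal_mult_left_mono) auto
      also have "\<dots> = enn2ereal (ennreal (1 / c0) * Linf_norm Om f)"
        using c0 by (simp add: times_ennreal.rep_eq enn2ereal_ennreal)
      finally show ?thesis using C(1) by (rule order_trans)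
    qed
    show "AE x in lebesgue_on Om. ereal (u x) \<le> max 0 (max (ereal (1 / c0) * ess_sup_on Om f) (bdry_bound u))"
      using eq nonneg_sub by (intro two[OF c0 P]) auto
    show "AE x in lebesgue_on Om. ereal (- u x) \<le>
        max 0 (max (ereal (1 / c0) * ess_sup_on Om (\<lambda>x. - f x)) (bdry_bound (\<lambda>x. - u x)))"
      using eq nonneg_sub a_minus[OF mK test_cone_subset]
      by (intro upper_bound_inhomogeneous[OF mK c0 P fm(2) ff(2)]) (fastforce simp: inner_minus)
    show "max 0 (max (ereal (1 / c0) * ess_sup_on Om f) (bdry_bound u)) \<le> enn2ereal ?C"
      by (intro max.boundedI ess[OF fm(1) refl] order_trans[OF bdry_bound_le_norm[OF uK] C(2)]) simp
    show "max 0 (max (ereal (1 / c0) * ess_sup_on Om (\<lambda>x. - f x)) (bdry_bound (\<lambda>x. - u x))) \<le> enn2ereal ?C"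
      by (intro max.boundedI ess[OF fm(2)] order_trans[OF minus_bound[OF mK] C(2)]) (simp_all add: Linf_norm_def)
  qed
  show ?thesis
    using one two three four five six by blast
qed

end
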